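(* Let $q$ be a complex number with $|q|<1$. Then the following three identities hold: $$\sum_{k=0}^{\infty}q^{\binom{k+1}{2}}\frac{(q;q)_{k}}{(q^3;q^2)_{k}}=\frac{(q^2;q^2)_{\infty}^2}{(q,q^3;q^2)_{\infty}},$$ $$\sum_{k=0}^{\infty}q^{\binom{k+1}{2}}[3k+2]\frac{(q;q)_{k}^2(q^{2};q^2)_{k}}{(q^3;q^2)_{k}^3}=\frac{(q^2;q^2)_{\infty}^4}{(q;q^2)_{\infty}^2(q^3;q^2)_{\infty}^2},$$ $$\sum_{k=0}^{\infty}q^{6k^2}\frac{(q;q^2)_{k}^3}{(q^2;q^2)_{k}^3}\cdot\frac{(1+q^{1+2k})^3(1-q^{1+6k})-q^{1+6k}(1-q^{3+6k})}{(1-q^3)(1+q)(-q^2;q)_{2k}^3}=\frac{(q^3,q^5;q^2)_{\infty}}{(q^4;q^2)_{\infty}^2}.$$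
   Context: For complex $x$ and $p$ with $|p|<1$, the $q$-shifted factorials with base $p$ are $(x;p)_{\infty}=\prod_{i=0}^{\infty}(1-xp^i)$ and, for an integer $n\ge 0$, $(x;p)_n=(x;p)_\infty/(xp^n;p)_\infty$, i.e. $(x;p)_n=\prod_{i=0}^{n-1}(1-xp^i)$. The compact notation $(x_1,\dots,x_r;p)_m=(x_1;p)_m\cdots(x_r;p)_m$ is used for $m$ a nonnegative integer or $\infty$. A power such as $(x;p)_m^3$ means $((x;p)_m)^3$. The $q$-integer is $[n]=1+q+\cdots+q^{n-1}$. *)

theory Defs
  imports "HOL-Analysis.Analysis"
begin

definition qpoch :: "complex \<Rightarrow> complex \<Rightarrow> nat \<Rightarrow> complex" where
  "qpoch x p n = (\<Prod>i<n. 1 - x * p ^ i)"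

(* Meant for norm p < 1, where the product converges. The library's prodinf admits zero
   factors, so the value is then 0, as usual, if some factor vanishes. *)
definition qpoch_inf :: "complex \<Rightarrow> complex \<Rightarrow> complex" where
  "qpoch_inf x p = (\<Prod>i. 1 - x * p ^ i)"

definition q_int :: "complex \<Rightarrow> nat \<Rightarrow> complex" where
  "q_int q n = (\<Sum>i<n. q ^ i)"

end

theory Submission
  imports Defs
begin

text \<open>
  Andrews' \<open>q\<close>-analogue of Gauss' second sum and the nonterminating very-well-poised \<open>6\<phi>5\<close> sum
  each satisfy a first-order recurrence, proved by telescoping, when one parameter (for \<open>6\<phi>5\<close>,
  the reciprocal of one parameter) is multiplied by the base \<open>q\<^sup>2\<close> or \<open>p\<close>. Iterating it sends that
  parameter to \<open>0\<close>, and the series that remains is obtained from a choice of parameters for which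
  only the first term survives. The first identity is an instance of Andrews' sum. The other two
  are WZ companions \<open>\<Sum>n. G n 0 = \<Sum>k. F 0 k\<close>, where \<open>\<Sum>k. F 0 k\<close> is an instance of the
  \<open>6\<phi>5\<close> sum.
\<close>

section \<open>Shifted factorials\<close>

text \<open>Reciprocals are used because a very-well-poised parameter x enters through (x;p)_k /
  x^k, which is a polynomial in b = 1/x. The confluent case of an infinite x is then the ordinary
  value b = 0; it is both the end point of the iteration and a case that the third identity needs.
  The price is that q = 0 has to be split off wherever q itself is a parameter. Exchanging the
  iteration limit with the infinite sum uses Tannery's theorem, so the terms need a majorant uniform
  in the number of shifts. This is what the bounds on shifted factorials and on their reciprocals
  provide. The second and third summands mix shifted factorials of base q and q^2, so the
  \<open>6\<phi>5\<close> sum does not apply to them directly. In the WZ pairs the row n = 0 lives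
  in base q^2 alone, whereas the column k = 0 carries the mixed bases.\<close>

lemma qpoch_0 [simp]: "qpoch x p 0 = 1"
  by (simp add: qpoch_def)

lemma qpoch_Suc: "qpoch x p (Suc n) = qpoch x p n * (1 - x * p ^ n)"
  by (simp add: qpoch_def)

lemma qpoch_add: "qpoch x p (m + n) = qpoch x p m * qpoch (x * p ^ m) p n"
  by (induction n) (simp_all add: qpoch_Suc power_add mult_ac)

lemma qpoch_Suc': "qpoch x p (Suc n) = (1 - x) * qpoch (x * p) p n"
  using qpoch_add[of x p 1 n] by (simp add: qpoch_Suc)

lemma qpoch_eq_0_iff: "qpoch x p n = 0 \<longleftrightarrow> (\<exists>i<n. x * p ^ i = 1)"
  by (auto simp: qpoch_def)

lemma mult_power_neq_1:
  fixes x p :: complex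
  assumes "norm x < 1" "norm p < 1"
  shows "x * p ^ i \<noteq> 1"
proof
  assume "x * p ^ i = 1"
  then have "norm x * norm p ^ i = 1"
    by (metis norm_mult norm_one norm_power)
  moreover have "norm x * norm p ^ i \<le> norm x * 1"
    using assms by (intro mult_left_mono power_le_one) auto
  ultimately show False
    using assms by simp
qed

lemma qpoch_nonzero: "norm x < 1 \<Longrightarrow> norm p < 1 \<Longrightarrow> qpoch x p n \<noteq> 0"
  by (auto simp: qpoch_eq_0_iff mult_power_neq_1)

lemma sum_power_le:
  fixes r :: real
  assumes "0 \<le> r" "r < 1"
  shows "(\<Sum>i<n. r ^ i) \<le> 1 / (1 - r)"
  using sum_le_suminf[of "\<lambda>i. r ^ i" "{..<n}"] assms
  by (simp add: summable_geometric suminf_geometric)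

text \<open>Each factor is at most \<open>r * (1 + s / r * norm p ^ i)\<close>, and 1 + t <= exp t
  leaves a geometric sum in the exponent. A general \<open>r\<close> serves both
  \<open>qpoch\<close>, whose factors tend to 1, and \<open>rpoch b\<close>, whose factors tend to
  \<open>b\<close>.\<close>

lemma norm_prod_add_power_le:
  fixes u w :: "nat \<Rightarrow> complex"
  assumes "norm p < 1" "r > 0" "\<And>i. norm (u i) \<le> r" "\<And>i. norm (w i) \<le> s * norm p ^ i"
  shows "norm (\<Prod>i<n. u i - w i) \<le> exp (s / r / (1 - norm p)) * r ^ n"
proof -
  have s: "s \<ge> 0"
    using order_trans[OF norm_ge_zero assms(4)[of 0]] by simp
  have "norm (\<Prod>i<n. u i - w i) \<le> (\<Prod>i<n. r * (1 + s / r * norm p ^ i))"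
    unfolding prod_norm [symmetric]
  proof (rule prod_mono, intro conjI)
    fix i
    have "norm (u i - w i) \<le> r + s * norm p ^ i"
      using norm_triangle_ineq4[of "u i" "w i"] assms(3)[of i] assms(4)[of i] by linarith
    then show "norm (u i - w i) \<le> r * (1 + s / r * norm p ^ i)"
      using \<open>r > 0\<close> by (simp add: distrib_left)
  qed auto
  also have "\<dots> = r ^ n * (\<Prod>i<n. 1 + s / r * norm p ^ i)"
    by (simp add: prod.distrib)
  also have "(\<Prod>i<n. 1 + s / r * norm p ^ i) \<le> exp (\<Sum>i<n. s / r * norm p ^ i)"
    using s assms by (intro prod_le_exp_sum) auto
  also have "(\<Sum>i<n. s / r * norm p ^ i) \<le> s / r * (1 / (1 - norm p))"
    unfolding sum_distrib_left [symmetric]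
    using s assms by (intro mult_left_mono sum_power_le) auto
  finally show ?thesis
    using \<open>r > 0\<close> by (simp add: mult_ac)
qed

lemma norm_qpoch_le:
  assumes "norm p < 1" "norm x \<le> s"
  shows "norm (qpoch x p n) \<le> exp (s / (1 - norm p))"
  using norm_prod_add_power_le[of p 1 "\<lambda>_. 1" "\<lambda>i. x * p ^ i" s n] assms
  by (simp add: qpoch_def norm_mult norm_power mult_right_mono)

lemma convergent_prod_qpoch:
  assumes "norm p < 1"
  shows "convergent_prod (\<lambda>i. 1 - x * p ^ i :: complex)"
proof -
  have "summable (\<lambda>i. norm x * norm p ^ i)"
    using assms by (intro summable_mult summable_geometric) auto
  then have "summable (\<lambda>i. norm ((1 - x * p ^ i) - 1))"
    by (simp add: norm_mult norm_power)
  then show ?thesis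
    by (intro abs_convergent_prod_imp_convergent_prod summable_imp_abs_convergent_prod)
qed

lemma qpoch_tendsto: "norm p < 1 \<Longrightarrow> qpoch x p \<longlonglongrightarrow> qpoch_inf x p"
  using convergent_prod_LIMSEQ[OF convergent_prod_qpoch, of p x]
  unfolding qpoch_def qpoch_inf_def by (simp add: LIMSEQ_lessThan_iff_atMost)

lemma qpoch_inf_nonzero:
  assumes "norm p < 1" "\<And>i. x * p ^ i \<noteq> 1"
  shows "qpoch_inf x p \<noteq> 0"
  unfolding qpoch_inf_def
  by (rule prodinf_nonzero[OF convergent_prod_qpoch]) (use assms in auto)

lemma qpoch_inf_0 [simp]: "qpoch_inf 0 p = 1"
  by (simp add: qpoch_inf_def)

lemma qpoch_inf_Suc:
  assumes "norm p < 1"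
  shows "qpoch_inf x p = (1 - x) * qpoch_inf (x * p) p"
proof (rule LIMSEQ_unique)
  show "(\<lambda>n. qpoch x p (Suc n)) \<longlonglongrightarrow> qpoch_inf x p"
    using qpoch_tendsto[OF assms] by (rule LIMSEQ_Suc)
  show "(\<lambda>n. qpoch x p (Suc n)) \<longlonglongrightarrow> (1 - x) * qpoch_inf (x * p) p"
    unfolding qpoch_Suc' by (intro tendsto_intros qpoch_tendsto assms)
qed

lemma bounded_range_mult:
  fixes f g :: "'a \<Rightarrow> complex"
  assumes "bounded (range f)" "bounded (range g)"
  shows "bounded (range (\<lambda>x. f x * g x))"
proof -
  obtain B C where "\<And>x. norm (f x) \<le> B" "\<And>x. norm (g x) \<le> C"
    using assms by (auto simp: bounded_iff)
  then have "norm (f x * g x) \<le> B * C" for x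
    unfolding norm_mult by (intro mult_mono) (auto intro: order_trans[OF norm_ge_zero])
  then show ?thesis
    by (auto simp: bounded_iff)
qed

lemma bounded_qpoch:
  assumes "norm p < 1" "bounded (range y)"
  shows "bounded (range (\<lambda>x. qpoch (y x) p (n x)))"
proof -
  obtain s where "\<And>x. norm (y x) \<le> s"
    using assms by (auto simp: bounded_iff)
  then show ?thesis
    using norm_qpoch_le[OF \<open>norm p < 1\<close>] by (fastforce simp: bounded_iff)
qed

lemma norm_mult_power_le: "norm p < 1 \<Longrightarrow> norm (x * p ^ n :: complex) \<le> norm x"
  by (simp add: norm_mult norm_power mult_left_le power_le_one)

text \<open>The bound is uniform in the shift \<open>m\<close> as well as in the length: the
  reciprocal of the shifted product is (y;p)_m / (y;p)_(m+n), and the reciprocals of the (y;p)_k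
  converge because the infinite product does not vanish.\<close>

lemma bounded_inverse_qpoch:
  assumes "norm p < 1" "\<And>i. y * p ^ i \<noteq> 1"
  shows "bounded (range (\<lambda>x. inverse (qpoch (y * p ^ m x) p (n x))))"
proof -
  have "(\<lambda>n. inverse (qpoch y p n)) \<longlonglongrightarrow> inverse (qpoch_inf y p)"
    using assms by (intro tendsto_inverse qpoch_tendsto qpoch_inf_nonzero)
  then have "bounded (range (\<lambda>n. inverse (qpoch y p n)))"
    by (rule convergent_imp_bounded)
  then have "bounded (range (\<lambda>x. inverse (qpoch y p (m x + n x))))"
    by (rule bounded_subset) auto
  moreover have "bounded (range (\<lambda>x. qpoch y p (m x)))"
    using assms by (intro bounded_qpoch) auto
  ultimately have "bounded (range (\<lambda>x. qpoch y p (m x) * inverse (qpoch y p (m x + n x))))"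
    by (intro bounded_range_mult)
  moreover have "qpoch y p k \<noteq> 0" for k
    using assms(2) by (simp add: qpoch_eq_0_iff)
  ultimately show ?thesis
    by (simp add: qpoch_add field_simps)
qed

section \<open>Passing to the limit: iterated recurrences and WZ companions\<close>

text \<open>The assumption \<open>rel\<close> says that S(y), the sum of \<open>t y\<close>,
  satisfies (1 - Ay)(1 - By) S(y) = (1 - Cy)(1 - Dy) S(yp). Iterating from \<open>x\<close> builds
  up shifted factorials, while S(x p^m) tends to the sum of \<open>t 0\<close> by domination.
  Setting a constant to 0 removes its factor.\<close>

lemma contiguous_sum_limit:
  fixes t :: "complex \<Rightarrow> nat \<Rightarrow> complex"
  assumes p: "norm p < 1"
    and bound: "\<And>m k. norm (t (x * p ^ m) k) \<le> M k" "summable M"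
    and lim: "\<And>k. (\<lambda>m. t (x * p ^ m) k) \<longlonglongrightarrow> t 0 k"
    and rel: "\<And>m y. y = x * p ^ m \<Longrightarrow>
        (\<lambda>N. \<Sum>k\<le>N. (1 - A * y) * (1 - B * y) * t y k
                    - (1 - C * y) * (1 - D * y) * t (y * p) k) \<longlonglongrightarrow> 0"
  shows "summable (t x)"
    and "(\<Sum>k. t x k) * qpoch_inf (A * x) p * qpoch_inf (B * x) p =
         qpoch_inf (C * x) p * qpoch_inf (D * x) p * (\<Sum>k. t 0 k)"
proof -
  have summ: "summable (t (x * p ^ m))" for m
    by (rule summable_comparison_test'[OF bound(2), where N = 0]) (rule bound(1))
  from this[of 0] show "summable (t x)"
    by simp
  define S where "S m = (\<Sum>k. t (x * p ^ m) k)" for m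
  have step: "(1 - A * (x * p ^ m)) * (1 - B * (x * p ^ m)) * S m =
        (1 - C * (x * p ^ m)) * (1 - D * (x * p ^ m)) * S (Suc m)" for m
  proof -
    define y where "y = x * p ^ m"
    have "(\<lambda>k. (1 - A * y) * (1 - B * y) * t y k - (1 - C * y) * (1 - D * y) * t (y * p) k) sums
          ((1 - A * y) * (1 - B * y) * S m - (1 - C * y) * (1 - D * y) * S (Suc m))"
      unfolding S_def y_def
      using summable_sums[OF summ[of m]] summable_sums[OF summ[of "Suc m"]]
      by (intro sums_diff sums_mult) (simp_all add: mult_ac)
    then show ?thesis
      using LIMSEQ_unique[OF rel[OF y_def]] unfolding sums_def_le y_def by fastforce
  qed
  have iter: "S 0 * qpoch (A * x) p m * qpoch (B * x) p m =
        qpoch (C * x) p m * qpoch (D * x) p m * S m" for m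
  proof (induction m)
    case (Suc m)
    have "S 0 * qpoch (A * x) p (Suc m) * qpoch (B * x) p (Suc m) =
      (S 0 * qpoch (A * x) p m * qpoch (B * x) p m) * ((1 - A * (x * p ^ m)) * (1 - B * (x * p ^ m)))"
      by (simp add: qpoch_Suc mult_ac)
    also have "\<dots> = qpoch (C * x) p m * qpoch (D * x) p m *
        ((1 - A * (x * p ^ m)) * (1 - B * (x * p ^ m)) * S m)"
      unfolding Suc by (simp only: mult_ac)
    also have "\<dots> = qpoch (C * x) p (Suc m) * qpoch (D * x) p (Suc m) * S (Suc m)"
      unfolding step by (simp add: qpoch_Suc mult_ac)
    finally show ?case .
  qed simp
  have "S \<longlonglongrightarrow> (\<Sum>k. t 0 k)"
    unfolding S_def
    using tannerys_theorem[OF lim _ bound(2)] bound(1) by (simp add: always_eventually)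
  then have "(\<lambda>m. qpoch (C * x) p m * qpoch (D * x) p m * S m) \<longlonglongrightarrow>
      qpoch_inf (C * x) p * qpoch_inf (D * x) p * (\<Sum>k. t 0 k)"
    by (intro tendsto_mult qpoch_tendsto p)
  moreover have "(\<lambda>m. S 0 * qpoch (A * x) p m * qpoch (B * x) p m) \<longlonglongrightarrow>
      S 0 * qpoch_inf (A * x) p * qpoch_inf (B * x) p"
    by (intro tendsto_mult tendsto_const qpoch_tendsto p)
  ultimately have "S 0 * qpoch_inf (A * x) p * qpoch_inf (B * x) p =
      qpoch_inf (C * x) p * qpoch_inf (D * x) p * (\<Sum>k. t 0 k)"
    unfolding iter using LIMSEQ_unique by blast
  then show "(\<Sum>k. t x k) * qpoch_inf (A * x) p * qpoch_inf (B * x) p =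
         qpoch_inf (C * x) p * qpoch_inf (D * x) p * (\<Sum>k. t 0 k)"
    by (simp add: S_def)
qed

text \<open>Summing the relation over k telescopes to \<open>- G n 0\<close>, since
  \<open>G n\<close> tends to 0. Partial sums of \<open>G n 0\<close> are therefore differences of
  row sums of \<open>F\<close>, and the factor \<open>c n\<close> makes the far row sum
  vanish.\<close>

lemma wz_companion:
  fixes F G :: "nat \<Rightarrow> nat \<Rightarrow> complex"
  assumes wz: "\<And>n k. F (Suc n) k - F n k = G n (Suc k) - G n k"
    and bound: "\<And>n k. norm (F n k) \<le> c n * b k" "c \<longlonglongrightarrow> 0" "summable b"
    and G: "\<And>n. G n \<longlonglongrightarrow> 0"
  shows "(\<lambda>n. G n 0) sums (\<Sum>k. F 0 k)"
proof -
  have F: "summable (F n)" for n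
    by (rule summable_comparison_test'[where N = 0 and g = "\<lambda>k. c n * b k"])
       (use bound in \<open>auto intro: summable_mult\<close>)
  have step: "(\<Sum>k. F (Suc n) k) - (\<Sum>k. F n k) = - G n 0" for n
  proof -
    have "(\<lambda>k. F (Suc n) k - F n k) sums ((\<Sum>k. F (Suc n) k) - (\<Sum>k. F n k))"
      by (intro sums_diff summable_sums F)
    moreover have "(\<lambda>k. F (Suc n) k - F n k) sums (0 - G n 0)"
      unfolding wz by (rule telescope_sums[OF G])
    ultimately show ?thesis
      using sums_unique2 by fastforce
  qed
  have "(\<Sum>n<N. G n 0) = (\<Sum>k. F 0 k) - (\<Sum>k. F N k)" for N
  proof (induction N)
    case (Suc N)
    then show ?case
      using step[of N] by (simp add: diff_eq_eq)
  qed simp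
  moreover have "(\<lambda>N. \<Sum>k. F N k) \<longlonglongrightarrow> 0"
  proof (rule Lim_null_comparison)
    show "\<forall>\<^sub>F N in sequentially. norm (\<Sum>k. F N k) \<le> c N * suminf b"
    proof (rule always_eventually, rule allI)
      fix N
      have "norm (\<Sum>k. F N k) \<le> (\<Sum>k. c N * b k)"
        by (intro norm_suminf_le summable_mult bound) 
      then show "norm (\<Sum>k. F N k) \<le> c N * suminf b"
        using bound(3) by (simp add: suminf_mult)
    qed
    show "(\<lambda>N. c N * suminf b) \<longlonglongrightarrow> 0"
      using tendsto_mult_right[OF bound(2), of "suminf b"] by simp
  qed
  ultimately show ?thesis
    unfolding sums_def using tendsto_diff[OF tendsto_const[of "\<Sum>k. F 0 k"]] by fastforce
qed

lemma bounded_mult_power: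
  "norm p < 1 \<Longrightarrow> bounded (range (\<lambda>x. y * p ^ m x :: complex))"
  by (rule boundedI[where B = "norm y"]) (auto intro: norm_mult_power_le)

lemma power_tendsto_0_offset: "norm (p::complex) < 1 \<Longrightarrow> (\<lambda>m. x * p ^ m) \<longlonglongrightarrow> 0"
  using tendsto_mult_right_zero[OF LIMSEQ_power_zero] by blast

lemma tendsto_qpoch: "(f \<longlongrightarrow> l) F \<Longrightarrow> ((\<lambda>m. qpoch (f m) p n) \<longlongrightarrow> qpoch l p n) F"
  unfolding qpoch_def by (intro tendsto_intros)

lemma qpoch_zero_left [simp]: "qpoch 0 p n = 1"
  by (simp add: qpoch_def)

text \<open>The reciprocal parameters allow the value \<open>0\<close>:
  \<open>rpoch b p n = b ^ n * qpoch (1 / b) p n\<close> if \<open>b \<noteq> 0\<close>.\<close>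

definition rpoch :: "complex \<Rightarrow> complex \<Rightarrow> nat \<Rightarrow> complex" where
  "rpoch b p n = (\<Prod>i<n. b - p ^ i)"

lemma rpoch_0 [simp]: "rpoch b p 0 = 1"
  by (simp add: rpoch_def)

lemma rpoch_Suc: "rpoch b p (Suc n) = rpoch b p n * (b - p ^ n)"
  by (simp add: rpoch_def)

lemma rpoch_1: "rpoch 1 p n = (if n = 0 then 1 else 0)"
  by (auto simp: rpoch_def intro!: bexI[of _ 0])

text \<open>Every factor after the first is \<open>p\<close> times a factor of
  \<open>rpoch b\<close>. This replaces the usual index shift of (x;p)_n and stays valid at
  \<open>b = 0\<close>.\<close>

lemma rpoch_mult_Suc: "rpoch (b * p) p (Suc n) = (b * p - 1) * p ^ n * rpoch b p n"
proof (induction n)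
  case (Suc n)
  show ?case
    unfolding rpoch_Suc[of "b * p" p "Suc n"] Suc by (simp add: rpoch_Suc algebra_simps)
qed (simp add: rpoch_Suc)

lemma tendsto_rpoch: "(f \<longlongrightarrow> l) F \<Longrightarrow> ((\<lambda>m. rpoch (f m) p n) \<longlongrightarrow> rpoch l p n) F"
  unfolding rpoch_def by (intro tendsto_intros)

lemma rpoch_inverse: "b \<noteq> 0 \<Longrightarrow> rpoch (1 / b) p n = qpoch b p n / b ^ n"
  by (induction n) (simp_all add: rpoch_Suc qpoch_Suc field_simps)

text \<open>\<open>rpoch b p n\<close> grows like the n-th power of \<open>b\<close>; normalising by
  a positive \<open>r\<close> instead of \<open>norm b\<close> keeps the quotient meaningful for
  \<open>b = 0\<close>.\<close>

lemma bounded_rpoch: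
  assumes "norm p < 1" "r > 0" "\<And>x. norm (b x) \<le> r"
  shows "bounded (range (\<lambda>x. rpoch (b x) p (n x) / of_real (r ^ n x)))"
proof (rule boundedI, clarify)
  fix x
  have "norm (rpoch (b x) p (n x)) \<le> exp (1 / r / (1 - norm p)) * r ^ n x"
    unfolding rpoch_def
    by (rule norm_prod_add_power_le) (use assms in \<open>auto simp: norm_power\<close>)
  then show "norm (rpoch (b x) p (n x) / of_real (r ^ n x)) \<le> exp (1 / r / (1 - norm p))"
    using \<open>r > 0\<close> by (simp add: norm_divide norm_power pos_divide_le_eq)
qed

section \<open>The very-well-poised sum\<close>

text \<open>Very-well-poised terms with the parameters \<open>1 / b\<close>, \<open>1 / c\<close>, \<open>1 / d\<close>, without the usual
  normalising factor \<open>1 / (1 - a)\<close>.\<close>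

definition wp_term ::
  "complex \<Rightarrow> complex \<Rightarrow> complex \<Rightarrow> complex \<Rightarrow> complex \<Rightarrow> nat \<Rightarrow> complex" where
  "wp_term a p b c d k = (1 - a * p ^ (2 * k)) * qpoch a p k / qpoch p p k *
     (rpoch b p k * rpoch c p k * rpoch d p k /
      (qpoch (a * p * b) p k * qpoch (a * p * c) p k * qpoch (a * p * d) p k)) * (a * p) ^ k"

lemma wp_term_commute:
  "wp_term a p b c d = wp_term a p b d c" "wp_term a p b c d = wp_term a p c b d"
  by (simp_all add: wp_term_def fun_eq_iff mult_ac)

text \<open>The right-hand side is an explicit antidifference of the combined terms. The parameter
  \<open>d\<close> appears in it with index \<open>N\<close>, against \<open>Suc N\<close> for
  \<open>b\<close> and \<open>c\<close>, because \<open>rpoch d p N\<close> is the common part of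
  \<open>rpoch d p (Suc N)\<close> and \<open>rpoch (d * p) p (Suc N)\<close>.\<close>

lemma wp_contiguous:
  assumes p: "norm p < 1"
    and nz: "\<And>i. a * p * b * p ^ i \<noteq> 1" "\<And>i. a * p * c * p ^ i \<noteq> 1" "\<And>i. a * p * d * p ^ i \<noteq> 1"
  shows "(\<Sum>k\<le>N. (1 - a * p * d) * (1 - a * p * b * c * d) * wp_term a p b c d k
                - (1 - a * p * b * d) * (1 - a * p * c * d) * wp_term a p b c (d * p) k)
       = - (a * p * d) * (qpoch a p (Suc N) / qpoch p p N *
          (rpoch b p (Suc N) * rpoch c p (Suc N) * rpoch d p N /
           (qpoch (a * p * b) p N * qpoch (a * p * c) p N * qpoch (a * p * (d * p)) p N)) * (a * p) ^ N)"
    (is "_ = ?g N")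
proof (induction N)
  case 0
  show ?case
    by (simp add: wp_term_def qpoch_Suc rpoch_Suc algebra_simps)
next
  case (Suc N)
  define Y where "Y = p ^ N"
  define Q where "Q = qpoch (a * p * (d * p)) p (Suc N)"
  \<comment> \<open>\<open>W\<close> is common to both new terms and to both values of the
    antidifference. Once it is factored out, the induction step is a polynomial identity in
    \<open>a\<close>, \<open>b\<close>, \<open>c\<close>, \<open>d\<close>, \<open>p\<close> and
    \<open>Y\<close>.\<close>
  define W where "W = qpoch a p (Suc N) * rpoch b p (Suc N) * rpoch c p (Suc N) * rpoch d p N * (a * p) ^ N /
    (qpoch p p (Suc N) * qpoch (a * p * b) p (Suc N) * qpoch (a * p * c) p (Suc N) * Q)"
  have nz0: "qpoch p p n \<noteq> 0" "qpoch (a * p * b) p n \<noteq> 0" "qpoch (a * p * c) p n \<noteq> 0"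
     "qpoch (a * p * d) p n \<noteq> 0" for n
    using nz qpoch_nonzero[OF p p] by (auto simp: qpoch_eq_0_iff)
  have d1: "1 - a * p * d \<noteq> 0"
    using nz(3)[of 0] by auto
  have q: "qpoch (a * p * d) p (Suc n) = (1 - a * p * d) * qpoch (a * p * (d * p)) p n" for n
    using qpoch_Suc'[of "a * p * d" p n] by (simp add: mult_ac)
  have nzQ: "qpoch (a * p * (d * p)) p n \<noteq> 0" for n
    using q[of n] nz0(4)[of "Suc n"] by auto
  have X2: "p ^ (2 * Suc N) = (p * Y) ^ 2"
    by (simp add: Y_def power_even_eq power_mult_distrib power2_eq_square)
  define P where "P = qpoch (a * p * (d * p)) p N"
  have QS: "Q = P * (1 - a * p * d * p * Y)"
    unfolding Q_def P_def Y_def by (simp add: qpoch_Suc mult_ac)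
  have P: "P \<noteq> 0" "1 - a * p * d * p * Y \<noteq> 0"
    using nzQ[of N] nzQ[of "Suc N"] unfolding Q_def [symmetric] P_def [symmetric] QS by auto
  \<comment> \<open>Trades the first factor of the longer product for its last one, stated on plain
    variables so that the large terms need not be normalised.\<close>
  have cancel: "\<And>x y z u v w. x \<noteq> 0 \<Longrightarrow> v \<noteq> 0 \<Longrightarrow>
      x * (y / z * (u / (w * (x * P)))) = y * u / (z * w * (P * v)) * v"
    by (simp add: field_simps)
  have t1: "(1 - a * p * d) * wp_term a p b c d (Suc N) =
      W * ((1 - a * (p * Y)^2) * (d - Y) * (a * p) * (1 - a * p * d * p * Y))"
    unfolding wp_term_def W_def X2 q QS mult.assoc[of _ _ "(a * p) ^ Suc N", symmetric]
      P_def[symmetric] mult.assoc[of "1 - a * p * d" _ "(a * p) ^ Suc N", symmetric]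
      cancel[OF d1 P(2)]
    by (simp add: rpoch_Suc[of d] Y_def [symmetric] ac_simps)
  have t2: "wp_term a p b c (d * p) (Suc N) = W * ((1 - a * (p * Y)^2) * (d * p - 1) * Y * (a * p))"
    unfolding wp_term_def W_def X2 Q_def
    using nz0 nzQ[of "Suc N"]
    by (simp add: rpoch_mult_Suc Y_def field_simps)
  define P\<^sub>p where "P\<^sub>p = qpoch p p N"
  define P\<^sub>b where "P\<^sub>b = qpoch (a * p * b) p N"
  define P\<^sub>c where "P\<^sub>c = qpoch (a * p * c) p N"
  have PS: "qpoch p p (Suc N) = P\<^sub>p * (1 - p * Y)"
    "qpoch (a * p * b) p (Suc N) = P\<^sub>b * (1 - a * p * b * Y)"
    "qpoch (a * p * c) p (Suc N) = P\<^sub>c * (1 - a * p * c * Y)"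
    by (simp_all add: P\<^sub>p_def P\<^sub>b_def P\<^sub>c_def Y_def qpoch_Suc)
  have "P\<^sub>p * (1 - p * Y) \<noteq> 0" "P\<^sub>b * (1 - a * p * b * Y) \<noteq> 0" "P\<^sub>c * (1 - a * p * c * Y) \<noteq> 0"
    unfolding PS [symmetric] by (rule nz0)+
  then have g1: "?g N = - (a * p * d) * (W * (1 - p * Y) * (1 - a * p * b * Y) * (1 - a * p * c * Y) * (1 - a * p * d * p * Y))"
    unfolding W_def QS PS P_def [symmetric] P\<^sub>p_def [symmetric] P\<^sub>b_def [symmetric] P\<^sub>c_def [symmetric]
    using P by simp (simp add: mult_ac)
  have g2: "?g (Suc N) = - (a * p * d) * (W * (1 - a * p * Y) * (b - p * Y) * (c - p * Y) * (d - Y) * (a * p))"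
    unfolding W_def Q_def
    by (simp add: qpoch_Suc[of a p "Suc N"] rpoch_Suc[of b p "Suc N"] rpoch_Suc[of c p "Suc N"] 
        rpoch_Suc[of d] Y_def mult_ac)
  have "?g (Suc N) - ?g N = (1 - a * p * b * c * d) * ((1 - a * p * d) * wp_term a p b c d (Suc N))
      - (1 - a * p * b * d) * (1 - a * p * c * d) * wp_term a p b c (d * p) (Suc N)"
    unfolding g1 g2 t1 t2 by algebra
  then show ?case
    using Suc by (simp add: algebra_simps)
qed

lemma bounded_times_geometric_tendsto_0:
  fixes f :: "nat \<Rightarrow> complex"
  assumes "bounded (range f)" "norm z < 1"
  shows "(\<lambda>n. f n * z ^ n) \<longlonglongrightarrow> 0"
proof -
  obtain C where C: "\<And>n. norm (f n) \<le> C"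
    using assms(1) by (auto simp: bounded_iff)
  show ?thesis
  proof (rule Lim_null_comparison)
    show "\<forall>\<^sub>F n in sequentially. norm (f n * z ^ n) \<le> C * norm z ^ n"
      by (intro always_eventually allI) (simp add: norm_mult norm_power mult_right_mono C)
    show "(\<lambda>n. C * norm z ^ n) \<longlonglongrightarrow> 0"
      using assms(2) by (intro tendsto_mult_right_zero LIMSEQ_power_zero) auto
  qed
qed

lemma wp_limit:
  assumes p: "norm p < 1" and conv: "norm (a * p * b * c * d) < 1"
    and nz: "\<And>i. a * p * b * p ^ i \<noteq> 1" "\<And>i. a * p * c * p ^ i \<noteq> 1" "\<And>i. a * p * d * p ^ i \<noteq> 1"
  shows "summable (wp_term a p b c d)"
    and "(\<Sum>k. wp_term a p b c d k) * qpoch_inf (a * p * d) p * qpoch_inf (a * p * b * c * d) p =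
         qpoch_inf (a * p * b * d) p * qpoch_inf (a * p * c * d) p * (\<Sum>k. wp_term a p b c 0 k)"
proof -
  \<comment> \<open>The norms of \<open>b\<close>, \<open>c\<close>, \<open>d\<close> are enlarged
    by a small e > 0: the radii become positive, so division by their powers is possible, while by
    continuity the ratio of the geometric majorant stays below 1.\<close>
  obtain r s t where r: "r > 0" "norm b \<le> r" and s: "s > 0" "norm c \<le> s"
    and t: "t > 0" "norm d \<le> t" and rst: "norm (a * p) * (r * s * t) < 1"
  proof -
    have "((\<lambda>e. norm (a * p) * ((norm b + e) * (norm c + e) * (norm d + e))) \<longlongrightarrow>
        norm (a * p) * ((norm b + 0) * (norm c + 0) * (norm d + 0))) (at_right (0::real))"
      by (intro tendsto_intros)
    then have "\<forall>\<^sub>F e in at_right 0. norm (a * p) * ((norm b + e) * (norm c + e) * (norm d + e)) < 1"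
      by (rule order_tendstoD) (use conv in \<open>simp add: norm_mult mult_ac\<close>)
    moreover have "\<forall>\<^sub>F e in at_right (0::real). e > 0"
      by (rule eventually_at_right_less)
    ultimately have "\<forall>\<^sub>F e in at_right 0. e > 0 \<and> norm (a * p) * ((norm b + e) * (norm c + e) * (norm d + e)) < 1"
      by eventually_elim simp
    then obtain e where "e > 0" "norm (a * p) * ((norm b + e) * (norm c + e) * (norm d + e)) < 1"
      using eventually_happens'[OF trivial_limit_at_right_real] by blast
    then show ?thesis
      by (intro that[of "norm b + e" "norm c + e" "norm d + e"]) (auto intro: add_nonneg_pos)
  qed
  define z where "z = a * p * of_real (r * s * t)"
  have z: "norm z < 1"
    using rst r(1) s(1) t(1) unfolding z_def norm_mult norm_of_real by simp
  have pp: "p * p ^ i \<noteq> 1" for i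
    using mult_power_neq_1 p by blast
  have inv: "bounded (range (\<lambda>x. inverse (qpoch y p (n x))))" if "\<And>i. y * p ^ i \<noteq> 1" for n :: "'x \<Rightarrow> nat" and y
    using bounded_inverse_qpoch[OF p that, of "\<lambda>_. 0" n] by simp
  have dp: "norm (d * p ^ m) \<le> t" for m
    using norm_mult_power_le[OF p, of d m] t(2) by linarith
  have lin: "bounded (range (\<lambda>x. 1 - a * p ^ n x))" for n :: "'x \<Rightarrow> nat"
    by (intro bounded_minus_comp bounded_mult_power p) auto
  \<comment> \<open>The argument is a pair: \<open>fst x\<close> is the number of shifts of
    \<open>d\<close> and \<open>snd x\<close> the summation index, so that one constant serves for
    both.\<close>
  have bnd: "bounded (range (\<lambda>x. (1 - a * p ^ (2 * snd x)) * qpoch a p (snd x) * inverse (qpoch p p (snd x)) *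
      (rpoch b p (snd x) / of_real (r ^ snd x)) * (rpoch c p (snd x) / of_real (s ^ snd x)) *
      (rpoch (d * p ^ fst x) p (snd x) / of_real (t ^ snd x)) *
      inverse (qpoch (a * p * b) p (snd x)) * inverse (qpoch (a * p * c) p (snd x)) *
      inverse (qpoch (a * p * d * p ^ fst x) p (snd x))))"
    using pp nz r s t dp
    by (intro bounded_range_mult bounded_qpoch inv bounded_rpoch bounded_inverse_qpoch p lin) auto
  then obtain C where C: "norm ((1 - a * p ^ (2 * k)) * qpoch a p k * inverse (qpoch p p k) *
      (rpoch b p k / of_real (r ^ k)) * (rpoch c p k / of_real (s ^ k)) *
      (rpoch (d * p ^ m) p k / of_real (t ^ k)) *
      inverse (qpoch (a * p * b) p k) * inverse (qpoch (a * p * c) p k) *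
      inverse (qpoch (a * p * d * p ^ m) p k)) \<le> C" for m k
    unfolding bounded_iff by (auto simp del: norm_mult)
  have cancel: "x * (u / R) * (v / S) * (w / T) * i * j * l * (y * (R * S * T)) = x * u * v * w * i * j * l * y"
    if "R \<noteq> 0" "S \<noteq> 0" "T \<noteq> 0" for x u v w i j l y R S T :: complex
    using that by simp
  have term_eq: "wp_term a p b c (d * p ^ m) k = (1 - a * p ^ (2 * k)) * qpoch a p k * inverse (qpoch p p k) *
      (rpoch b p k / of_real (r ^ k)) * (rpoch c p k / of_real (s ^ k)) *
      (rpoch (d * p ^ m) p k / of_real (t ^ k)) *
      inverse (qpoch (a * p * b) p k) * inverse (qpoch (a * p * c) p k) *
      inverse (qpoch (a * p * d * p ^ m) p k) * z ^ k" for m k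
  proof -
    have zk: "z ^ k = (a * p) ^ k * (of_real (r ^ k) * of_real (s ^ k) * of_real (t ^ k))"
      by (simp add: z_def power_mult_distrib)
    have "of_real (r ^ k) \<noteq> (0 :: complex)" "of_real (s ^ k) \<noteq> (0 :: complex)" "of_real (t ^ k) \<noteq> (0 :: complex)"
      using r(1) s(1) t(1) by auto
    then show ?thesis
      unfolding zk by (subst cancel) (simp_all only: not_False_eq_True wp_term_def divide_inverse inverse_mult_distrib mult_ac)
  qed
  have bound: "norm (wp_term a p b c (d * p ^ m) k) \<le> C * norm z ^ k" for m k
    unfolding term_eq norm_mult[of _ "z ^ k"] norm_power by (intro mult_right_mono C) auto
  have summ: "summable (\<lambda>k. C * norm z ^ k)"
    using z by (intro summable_mult summable_geometric) auto
  have lim: "(\<lambda>m. wp_term a p b c (d * p ^ m) k) \<longlonglongrightarrow> wp_term a p b c 0 k" for k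
    unfolding wp_term_def
    by (intro tendsto_intros tendsto_rpoch tendsto_qpoch power_tendsto_0_offset p)
       (use pp nz in \<open>auto simp: qpoch_eq_0_iff\<close>)
  have rel: "(\<lambda>N. \<Sum>k\<le>N. (1 - a * p * y) * (1 - a * p * b * c * y) * wp_term a p b c y k
                - (1 - a * p * b * y) * (1 - a * p * c * y) * wp_term a p b c (y * p) k) \<longlonglongrightarrow> 0"
    if y: "y = d * p ^ m" for y m
  proof -
    have nzy: "a * p * y * p ^ i \<noteq> 1" for i
      using nz(3)[of "m + i"] by (simp add: y power_add mult_ac)
    have nzyp: "a * p * (y * p) * p ^ i \<noteq> 1" for i
      using nz(3)[of "Suc m + i"] by (simp add: y power_add mult_ac)
    have "bounded (range (\<lambda>N. qpoch a p (Suc N) * inverse (qpoch p p N) *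
      (rpoch b p (Suc N) / of_real (r ^ Suc N)) * (rpoch c p (Suc N) / of_real (s ^ Suc N)) *
      (rpoch y p N / of_real (t ^ N)) *
      inverse (qpoch (a * p * b) p N) * inverse (qpoch (a * p * c) p N) *
      inverse (qpoch (a * p * (y * p)) p N)))"
      using pp nz r s t dp y nzyp
      by (intro bounded_range_mult bounded_qpoch inv bounded_rpoch p) auto
    \<comment> \<open>The factor \<open>r * s\<close> compensates for the index \<open>Suc N\<close>
      of the normalised \<open>b\<close> and \<open>c\<close> products, whereas \<open>z ^ N\<close>
      supplies only \<open>N\<close> powers.\<close>
    from tendsto_mult_right_zero[OF bounded_times_geometric_tendsto_0[OF this z], of "- (a * p * y) * of_real (r * s)"]
    moreover have "- (a * p * y) * of_real (r * s) * (qpoch a p (Suc N) * inverse (qpoch p p N) *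
        (rpoch b p (Suc N) / of_real (r ^ Suc N)) * (rpoch c p (Suc N) / of_real (s ^ Suc N)) *
        (rpoch y p N / of_real (t ^ N)) *
        inverse (qpoch (a * p * b) p N) * inverse (qpoch (a * p * c) p N) *
        inverse (qpoch (a * p * (y * p)) p N) * z ^ N) =
      - (a * p * y) * (qpoch a p (Suc N) / qpoch p p N *
          (rpoch b p (Suc N) * rpoch c p (Suc N) * rpoch y p N /
           (qpoch (a * p * b) p N * qpoch (a * p * c) p N * qpoch (a * p * (y * p)) p N)) * (a * p) ^ N)" for N
    proof -
      have "of_real (r * s) * z ^ N = (a * p) ^ N * (of_real (r ^ Suc N) * of_real (s ^ Suc N) * of_real (t ^ N))"
        by (simp add: z_def power_mult_distrib mult_ac)
      then have zN: "of_real (r * s) * (w * z ^ N) =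
          w * ((a * p) ^ N * (of_real (r ^ Suc N) * of_real (s ^ Suc N) * of_real (t ^ N)))" for w
        by (simp only: mult.left_commute)
      have "of_real (r ^ Suc N) \<noteq> (0 :: complex)" "of_real (s ^ Suc N) \<noteq> (0 :: complex)" "of_real (t ^ N) \<noteq> (0 :: complex)"
        using r(1) s(1) t(1) by auto
      then show ?thesis
        unfolding mult.assoc[of "- (a * p * y)" "of_real (r * s)"] zN
        by (subst cancel) (simp_all only: not_False_eq_True divide_inverse inverse_mult_distrib mult_ac)
    qed
    ultimately show ?thesis
      unfolding wp_contiguous[OF p nz(1,2) nzy] by (simp only:)
  qed
  note * = contiguous_sum_limit[where t = "wp_term a p b c", OF p bound summ lim rel]
  show "summable (wp_term a p b c d)"
    by (rule *(1))
  show "(\<Sum>k. wp_term a p b c d k) * qpoch_inf (a * p * d) p * qpoch_inf (a * p * b * c * d) p =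
         qpoch_inf (a * p * b * d) p * qpoch_inf (a * p * c * d) p * (\<Sum>k. wp_term a p b c 0 k)"
    by (rule *(2))
qed

text \<open>Rogers' nonterminating \<open>6\<phi>5\<close> sum. The missing normalisation 1 / (1 -
  a) turns the usual (ap;p)_inf of the numerator into (a;p)_inf.\<close>

lemma wp_sum:
  assumes p: "norm p < 1" and conv: "norm (a * p * b * c * d) < 1"
    and nz: "\<And>i. a * p * b * p ^ i \<noteq> 1" "\<And>i. a * p * c * p ^ i \<noteq> 1" "\<And>i. a * p * d * p ^ i \<noteq> 1"
      "\<And>i. a * p * p ^ i \<noteq> 1"
  shows "wp_term a p b c d sums
    (qpoch_inf a p * qpoch_inf (a * p * b * c) p * qpoch_inf (a * p * b * d) p * qpoch_inf (a * p * c * d) p /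
     (qpoch_inf (a * p * b) p * qpoch_inf (a * p * c) p * qpoch_inf (a * p * d) p * qpoch_inf (a * p * b * c * d) p))"
proof -
  define S where "S b c d = (\<Sum>k. wp_term a p b c d k)" for b c d
  \<comment> \<open>At \<open>d = 1\<close> the factor \<open>rpoch 1 p k\<close> kills every later
    term. One application of the recurrence limit from here evaluates the fully confluent
    series.\<close>
  have "wp_term a p 0 0 1 k = (if k = 0 then 1 - a else 0)" for k
    by (simp add: wp_term_def rpoch_1)
  then have "S 0 0 1 = 1 - a"
    using sums_unique[OF sums_single[of 0 "\<lambda>_. 1 - a"]] by (simp add: S_def)
  moreover have "S 0 0 1 * qpoch_inf (a * p) p = S 0 0 0"
    using wp_limit(2)[of p a 0 0 1] p nz(4) by (simp add: S_def)
  ultimately have S0: "S 0 0 0 = qpoch_inf a p"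
    using qpoch_inf_Suc[OF p, of a] by simp
  have h1: "S b c d * qpoch_inf (a * p * d) p * qpoch_inf (a * p * b * c * d) p =
      qpoch_inf (a * p * b * d) p * qpoch_inf (a * p * c * d) p * S b c 0"
    using wp_limit(2)[OF p conv nz(1-3)] by (simp add: S_def)
  \<comment> \<open>Symmetry moves the next parameter into the last slot. With a zero among the
    reciprocals the convergence condition is automatic.\<close>
  have h2: "S b c 0 * qpoch_inf (a * p * c) p = qpoch_inf (a * p * b * c) p * S b 0 0"
    using wp_limit(2)[of p a b 0 c] p nz by (simp add: S_def wp_term_commute(1)[of a p b 0 c])
  have h3: "S b 0 0 * qpoch_inf (a * p * b) p = S 0 0 0"
    using wp_limit(2)[of p a 0 0 b] p nz
    by (simp add: S_def wp_term_commute(2)[of a p b 0 0] wp_term_commute(1)[of a p 0 b 0])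
  have "qpoch_inf (a * p * b) p \<noteq> 0" "qpoch_inf (a * p * c) p \<noteq> 0" "qpoch_inf (a * p * d) p \<noteq> 0"
    "qpoch_inf (a * p * b * c * d) p \<noteq> 0"
    using qpoch_inf_nonzero[OF p nz(1)] qpoch_inf_nonzero[OF p nz(2)] qpoch_inf_nonzero[OF p nz(3)]
      qpoch_inf_nonzero[OF p mult_power_neq_1[OF conv p]] by blast+
  moreover have "S b c d * (qpoch_inf (a * p * b) p * qpoch_inf (a * p * c) p * qpoch_inf (a * p * d) p *
      qpoch_inf (a * p * b * c * d) p) =
    S 0 0 0 * qpoch_inf (a * p * b * c) p * qpoch_inf (a * p * b * d) p * qpoch_inf (a * p * c * d) p"
    using h1 h2 h3 by algebra
  ultimately have "S b c d = qpoch_inf a p * qpoch_inf (a * p * b * c) p * qpoch_inf (a * p * b * d) p *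
      qpoch_inf (a * p * c * d) p /
     (qpoch_inf (a * p * b) p * qpoch_inf (a * p * c) p * qpoch_inf (a * p * d) p * qpoch_inf (a * p * b * c * d) p)"
    unfolding S0 by (simp add: nonzero_eq_divide_eq)
  then show ?thesis
    using summable_sums[OF wp_limit(1)[OF p conv nz(1-3)]] by (simp add: S_def)
qed

section \<open>Andrews' sum\<close>

lemma choose_2_Suc_Suc: "Suc n + 1 choose 2 = (n + 1 choose 2) + Suc n"
  by (simp add: numeral_2_eq_2)

lemma choose_2_ge: "n \<le> n + 1 choose 2"
  by (induction n) (simp_all add: numeral_2_eq_2)

text \<open>The summand in Andrews' q-analogue of Gauss' 2F1(a, b; (a+b+1)/2; 1/2). The quadratic
  exponent makes the series converge without a size condition on \<open>a\<close> or
  \<open>b\<close>; \<open>a\<close> comes last because it is the parameter to be iterated.\<close>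

definition qg_term :: "complex \<Rightarrow> complex \<Rightarrow> complex \<Rightarrow> nat \<Rightarrow> complex" where
  "qg_term q b a n = qpoch a q n * qpoch b q n * q ^ (n + 1 choose 2) /
     (qpoch q q n * qpoch (a * b * q) (q^2) n)"

text \<open>Again an explicit antidifference. The step \<open>a * q^2\<close> fits the base of
  (abq;q^2)_n, and costs two factors of the base-q product (a;q)_n.\<close>

lemma qg_contiguous:
  assumes q: "norm q < 1" and nz: "\<And>i. a * b * q * (q^2) ^ i \<noteq> 1"
  shows "(\<Sum>n\<le>N. (1 - b * q * a) * qg_term q b a n - (1 - q * a) * qg_term q b (a * q^2) n)
    = a * q ^ Suc N * qpoch (a * q) q N * qpoch b q (Suc N) * q ^ (N + 1 choose 2) /
      (qpoch q q N * qpoch (a * q^2 * b * q) (q^2) N)"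
    (is "_ = ?g N")
proof (induction N)
  case 0
  show ?case
    by (simp add: qg_term_def qpoch_Suc algebra_simps)
next
  case (Suc N)
  define Y where "Y = q ^ N"
  define Q where "Q = qpoch (a * q^2 * b * q) (q^2) (Suc N)"
  define W where "W = qpoch (a * q) q N * qpoch b q (Suc N) * q ^ (N + 1 choose 2) * q ^ Suc N /
    (qpoch q q (Suc N) * Q)"
  have q': "norm (q^2) < 1"
    using q by (simp add: norm_power power_less_one_iff)
  have nz0: "qpoch q q n \<noteq> 0" "qpoch (a * b * q) (q^2) n \<noteq> 0" for n
    using nz qpoch_nonzero[OF q q] by (auto simp: qpoch_eq_0_iff)
  have d1: "1 - a * b * q \<noteq> 0"
    using nz[of 0] by auto
  have Qeq: "qpoch (a * b * q) (q^2) (Suc n) = (1 - a * b * q) * qpoch (a * q^2 * b * q) (q^2) n" for n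
    using qpoch_Suc'[of "a * b * q" "q^2" n] by (simp add: mult_ac)
  have nzQ: "qpoch (a * q^2 * b * q) (q^2) n \<noteq> 0" for n
    using Qeq[of n] nz0(2)[of "Suc n"] by auto
  have Y2: "(q^2) ^ N = Y ^ 2"
    by (simp add: Y_def power_mult [symmetric] mult.commute)
  have QS: "Q = qpoch (a * q^2 * b * q) (q^2) N * (1 - a * b * q^3 * Y^2)"
    unfolding Q_def qpoch_Suc Y2 by (simp add: power2_eq_square power3_eq_cube mult_ac)
  have t1: "(1 - b * q * a) * qg_term q b a (Suc N) = W * ((1 - a) * (1 - a * b * q^3 * Y^2))"
    unfolding qg_term_def choose_2_Suc_Suc Qeq W_def QS power_add
    using nz0 nzQ[of N] nzQ[of "Suc N"] d1
    unfolding Q_def [symmetric] QS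
    by (simp add: qpoch_Suc'[of a] field_simps)
  have t2: "(1 - q * a) * qg_term q b (a * q^2) (Suc N) = W * ((1 - a * q * Y) * (1 - a * q * (q * Y)))"
  proof -
    \<comment> \<open>The prefactor is exactly the factor missing between (aq;q) and (aq^2;q), so
      both terms become multiples of (aq;q)_N.\<close>
    have "(1 - q * a) * qpoch (a * q^2) q (Suc N) = qpoch (a * q) q (Suc (Suc N))"
      using qpoch_Suc'[of "a * q" q "Suc N"] by (simp add: power2_eq_square mult_ac)
    then have "(1 - q * a) * qpoch (a * q^2) q (Suc N) = qpoch (a * q) q N * (1 - a * q * Y) * (1 - a * q * (q * Y))"
      by (simp add: qpoch_Suc Y_def)
    then show ?thesis
      unfolding qg_term_def choose_2_Suc_Suc W_def power_add Q_def
      by (simp add: mult.assoc[symmetric] del: power_Suc)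
  qed
  have g1: "?g N = a * W * (1 - q * Y) * (1 - a * b * q^3 * Y^2)"
    unfolding W_def QS using nz0[of "Suc N"] nzQ[of "Suc N"]
    unfolding Q_def [symmetric] QS
    by (simp add: qpoch_Suc[of q] Y_def mult_ac)
  have g2: "?g (Suc N) = a * W * q * (q * Y) * (1 - a * q * Y) * (1 - b * (q * Y))"
    unfolding W_def Q_def choose_2_Suc_Suc power_add
    by (simp add: qpoch_Suc[of "a * q"] qpoch_Suc[of b q "Suc N"] Y_def mult_ac)
  have "?g (Suc N) - ?g N = (1 - b * q * a) * qg_term q b a (Suc N) - (1 - q * a) * qg_term q b (a * q^2) (Suc N)"
    unfolding g1 g2 t1 t2 by algebra
  then show ?case
    using Suc by (simp add: algebra_simps)
qed

lemma norm_power_le_power: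
  fixes q :: complex
  assumes "norm q < 1" "n \<le> m"
  shows "norm (q ^ m) \<le> norm q ^ n"
  using assms by (simp add: norm_power power_decreasing)

lemma qg_limit:
  assumes q: "norm q < 1" and nz: "\<And>i. a * b * q * (q^2) ^ i \<noteq> 1"
  shows "summable (qg_term q b a)"
    and "(\<Sum>n. qg_term q b a n) * qpoch_inf (b * q * a) (q^2) =
         qpoch_inf (q * a) (q^2) * (\<Sum>n. qg_term q b 0 n)"
proof -
  have q2: "norm (q^2) < 1"
    using q by (simp add: norm_power power_less_one_iff)
  have qq: "q * q ^ i \<noteq> 1" for i
    using mult_power_neq_1 q by blast
  have inv: "bounded (range (\<lambda>x. inverse (qpoch y p (n x))))"
    if "norm p < 1" "\<And>i. y * p ^ i \<noteq> 1" for n :: "'x \<Rightarrow> nat" and y p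
    using bounded_inverse_qpoch[OF that, of "\<lambda>_. 0" n] by simp
  have "bounded (range (\<lambda>x. qpoch (a * (q^2) ^ fst x) q (snd x) * qpoch b q (snd x) * inverse (qpoch q q (snd x)) *
      inverse (qpoch (a * b * q * (q^2) ^ fst x) (q^2) (snd x))))"
    using qq nz
    by (intro bounded_range_mult bounded_qpoch inv bounded_inverse_qpoch bounded_mult_power q q2) auto
  then obtain C where C: "norm (qpoch (a * (q^2) ^ m) q n * qpoch b q n * inverse (qpoch q q n) *
      inverse (qpoch (a * b * q * (q^2) ^ m) (q^2) n)) \<le> C" for m n
    unfolding bounded_iff by (auto simp del: norm_mult)
  have C0: "C \<ge> 0"
    using order_trans[OF norm_ge_zero C] .
  have term_eq: "qg_term q b (a * (q^2) ^ m) n = (qpoch (a * (q^2) ^ m) q n * qpoch b q n * inverse (qpoch q q n) *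
      inverse (qpoch (a * b * q * (q^2) ^ m) (q^2) n)) * q ^ (n + 1 choose 2)" for m n
    by (simp add: qg_term_def divide_inverse mult_ac)
  have bound: "norm (qg_term q b (a * (q^2) ^ m) n) \<le> C * norm q ^ n" for m n
    unfolding term_eq norm_mult[of _ "q ^ (n + 1 choose 2)"]
    by (intro mult_mono C norm_power_le_power q choose_2_ge C0) auto
  have summ: "summable (\<lambda>n. C * norm q ^ n)"
    using q by (intro summable_mult summable_geometric) auto
  have lim: "(\<lambda>m. qg_term q b (a * (q^2) ^ m) n) \<longlonglongrightarrow> qg_term q b 0 n" for n
    unfolding qg_term_def
    by (intro tendsto_intros tendsto_qpoch power_tendsto_0_offset q2)
       (use qq in \<open>auto simp: qpoch_eq_0_iff\<close>)
  have rel: "(\<lambda>N. \<Sum>n\<le>N. (1 - b * q * y) * (1 - 0 * y) * qg_term q b y n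
                - (1 - q * y) * (1 - 0 * y) * qg_term q b (y * q^2) n) \<longlonglongrightarrow> 0"
    if y: "y = a * (q^2) ^ m" for y m
  proof -
    have nzy: "y * b * q * (q^2) ^ i \<noteq> 1" for i
      using nz[of "m + i"] by (simp add: y power_add mult_ac)
    have nzyp: "y * q^2 * b * q * (q^2) ^ i \<noteq> 1" for i
      using nz[of "Suc m + i"] by (simp add: y power_add mult_ac)
    have "bounded (range (\<lambda>N. 1 * q ^ (N + 1 choose 2)))"
      by (intro bounded_mult_power q)
    then have "bounded (range (\<lambda>N. qpoch (y * q) q N * qpoch b q (Suc N) * (1 * q ^ (N + 1 choose 2)) *
        inverse (qpoch q q N) * inverse (qpoch (y * q^2 * b * q) (q^2) N)))"
      using qq nzyp by (intro bounded_range_mult bounded_qpoch inv q q2) auto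
    from tendsto_mult_right_zero[OF bounded_times_geometric_tendsto_0[OF this q], of "y * q"]
    show ?thesis
      using qg_contiguous[OF q nzy] by (simp add: divide_inverse mult_ac)
  qed
  note * = contiguous_sum_limit[where t = "qg_term q b", where A = "b * q" and B = 0 and C = q and D = 0, OF q2 bound summ lim rel]
  show "summable (qg_term q b a)"
    by (rule *(1))
  show "(\<Sum>n. qg_term q b a n) * qpoch_inf (b * q * a) (q^2) =
         qpoch_inf (q * a) (q^2) * (\<Sum>n. qg_term q b 0 n)"
  proof -
    have "(\<Sum>n. qg_term q b a n) * qpoch_inf (b * q * a) (q^2) * qpoch_inf (0 * a) (q^2) =
        qpoch_inf (q * a) (q^2) * qpoch_inf (0 * a) (q^2) * (\<Sum>n. qg_term q b 0 n)"
      by (rule *(2))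
    then show ?thesis
      by simp
  qed
qed

lemma qg_sum:
  assumes q: "norm q < 1" and nz: "\<And>i. a * b * q * (q^2) ^ i \<noteq> 1"
  shows "qg_term q b a sums
    (qpoch_inf (a * q) (q^2) * qpoch_inf (b * q) (q^2) / (qpoch_inf q (q^2) * qpoch_inf (a * b * q) (q^2)))"
proof -
  define S where "S b a = (\<Sum>k. qg_term q b a k)" for b a
  have q2: "norm (q^2) < 1"
    using q by (simp add: norm_power power_less_one_iff)
  have qq: "q * (q^2) ^ i \<noteq> 1" for i
    using mult_power_neq_1[OF q q2] .
  have comm: "qg_term q 0 b = qg_term q b 0"
    by (simp add: qg_term_def fun_eq_iff mult_ac)
  have "qg_term q 0 1 k = (if k = 0 then 1 else 0)" for k
    \<comment> \<open>For k > 0 the factor (1;q)_k contains 1 - 1, so the series at a = 1, b = 0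
      reduces to its first term.\<close>
    by (cases k) (simp_all add: qg_term_def qpoch_Suc' numeral_2_eq_2)
  then have "S 0 1 = 1"
    using sums_unique[OF sums_single[of 0 "\<lambda>_. 1"]] by (simp add: S_def)
  moreover have "S 0 1 = qpoch_inf q (q^2) * S 0 0"
    using qg_limit(2)[of q 1 0] q by (simp add: S_def)
  ultimately have S00: "qpoch_inf q (q^2) * S 0 0 = 1"
    by simp
  have h1: "S b a * qpoch_inf (a * b * q) (q^2) = qpoch_inf (a * q) (q^2) * S b 0"
    using qg_limit(2)[OF q nz] by (simp add: S_def mult_ac)
  have h2: "S b 0 = qpoch_inf (b * q) (q^2) * S 0 0"
    using qg_limit(2)[of q b 0] q by (simp add: S_def comm mult_ac)
  have "qpoch_inf q (q^2) \<noteq> 0" "qpoch_inf (a * b * q) (q^2) \<noteq> 0"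
    using qpoch_inf_nonzero[OF q2 qq] qpoch_inf_nonzero[OF q2 nz] by blast+
  moreover have "S b a * (qpoch_inf q (q^2) * qpoch_inf (a * b * q) (q^2)) =
      qpoch_inf (a * q) (q^2) * qpoch_inf (b * q) (q^2)"
    using S00 h1 h2 by algebra
  ultimately have "S b a = qpoch_inf (a * q) (q^2) * qpoch_inf (b * q) (q^2) /
      (qpoch_inf q (q^2) * qpoch_inf (a * b * q) (q^2))"
    by (simp add: nonzero_eq_divide_eq)
  then show ?thesis
    using summable_sums[OF qg_limit(1)[OF q nz]] by (simp add: S_def)
qed

lemma norm_square_less_1: "norm q < 1 \<Longrightarrow> norm (q^2 :: complex) < 1"
  by (simp add: norm_power power_less_one_iff)

lemma power_neq_1:
  fixes q :: complex
  assumes "norm q < 1" "n > 0"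
  shows "q ^ n \<noteq> 1"
  using mult_power_neq_1[OF assms(1) assms(1), of "n - 1"] assms(2)
  by (cases n) auto

lemma bounded_power:
  "norm q < 1 \<Longrightarrow> bounded (range (\<lambda>x. q ^ n x :: complex))"
  using bounded_mult_power[of q 1] by simp

text \<open>This is the \<open>6\<phi>5\<close> sum with base and \<open>a\<close> both q^2 and all
  three parameters q: (a;p)_k cancels (p;p)_k, and (q;q^2)_k / (q^3;q^2)_k collapses to (1 - q) / (1
  - q^(2k+1)).\<close>

lemma lambert_sum:
  assumes q: "norm q < 1"
  shows "(\<lambda>k. q ^ k * (1 + q ^ (2 * k + 1)) / (1 - q ^ (2 * k + 1)) ^ 2) sums
    ((qpoch_inf (q^2) (q^2)) ^ 4 / (qpoch_inf q (q^2)) ^ 4)"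
proof (cases "q = 0")
  case True
  have "(\<lambda>k. q ^ k * (1 + q ^ (2 * k + 1)) / (1 - q ^ (2 * k + 1)) ^ 2) = (\<lambda>k. if k = 0 then 1 else 0)"
    by (auto simp: True fun_eq_iff)
  then show ?thesis
    using sums_single[of 0 "\<lambda>_. 1 :: complex"] by (simp add: True)
next
  case False
  define p where "p = q^2"
  have p: "norm p < 1"
    using q norm_square_less_1 p_def by auto
  have pars: "p * p * (1 / q) = q^3" "q^3 * (1 / q) = p" "p * (1 / q) = q"
    using False by (simp_all add: p_def field_simps eval_nat_numeral)
  have n3: "norm (q^3) < 1"
    using q by (simp add: norm_power power_less_one_iff)
  have nz: "p * p * (1 / q) * p ^ i \<noteq> 1" "p * p * p ^ i \<noteq> 1" for i
    unfolding pars using mult_power_neq_1[OF n3 p] power_neq_1[OF q, of "2 + 2 + 2 * i"]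
    by (simp_all add: p_def power_add power_mult)
  have "wp_term p p (1 / q) (1 / q) (1 / q) sums
    (qpoch_inf p p * qpoch_inf p p * qpoch_inf p p * qpoch_inf p p /
     (qpoch_inf (q^3) p * qpoch_inf (q^3) p * qpoch_inf (q^3) p * qpoch_inf q p))"
    using wp_sum[OF p _ nz(1) nz(1) nz(1) nz(2)] q unfolding pars by blast
  from sums_divide[OF this, of "(1 - q) ^ 3"]
  have "(\<lambda>k. wp_term p p (1 / q) (1 / q) (1 / q) k / (1 - q) ^ 3) sums
      (qpoch_inf p p ^ 4 / qpoch_inf q p ^ 4)"
    using qpoch_inf_Suc[OF p, of q]
    by (simp add: p_def eval_nat_numeral mult_ac)
  moreover have "wp_term p p (1 / q) (1 / q) (1 / q) k / (1 - q) ^ 3 =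
      q ^ k * (1 + q ^ (2 * k + 1)) / (1 - q ^ (2 * k + 1)) ^ 2" for k
  proof -
    define v where "v = q ^ (2 * k + 1)"
    have v: "1 - v \<noteq> 0" "1 - q \<noteq> 0"
      using power_neq_1[OF q, of "2 * k + 1"] power_neq_1[OF q, of 1] by (simp_all add: v_def)
    define B where "B = qpoch q p k"
    define D where "D = qpoch (q^3) p k"
    have D: "D \<noteq> 0"
      using qpoch_nonzero[OF n3 p] by (simp add: D_def)
    have "q * p ^ k = v"
      by (simp add: v_def p_def power_mult)
    moreover have "q * p = q^3"
      by (simp add: p_def eval_nat_numeral)
    ultimately have "(1 - q) * D = B * (1 - v)"
      using qpoch_Suc'[of q p k] by (simp add: qpoch_Suc B_def D_def)
    then have B: "B = (1 - q) * D / (1 - v)"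
      using v by (simp add: field_simps)
    have "wp_term p p (1 / q) (1 / q) (1 / q) k =
        (1 - p * p ^ (2 * k)) * (B / q ^ k) ^ 3 / D ^ 3 * (p * p) ^ k"
      unfolding wp_term_def pars rpoch_inverse[OF False] B_def D_def
      using qpoch_nonzero[OF p p] by (simp add: power3_eq_cube)
    also have "p * p ^ (2 * k) = v ^ 2"
      by (simp add: p_def v_def flip: power_mult power_Suc power_add)
    also have "(p * p) ^ k = q ^ k * (q ^ k) ^ 3"
      by (simp add: p_def flip: power_mult power_add)
    also have "(1 - v^2) * (B / q ^ k) ^ 3 / D ^ 3 * (q ^ k * (q ^ k) ^ 3) = 
        (1 - q) ^ 3 * ((1 - v^2) * q ^ k / (1 - v) ^ 3)"
      using False D by (simp add: B power_divide power_mult_distrib)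
    also have "(1 - v^2) * q ^ k / (1 - v) ^ 3 = q ^ k * (1 + v) / (1 - v) ^ 2"
    proof -
      have "1 - v^2 = (1 - v) * (1 + v)"
        by algebra
      then show ?thesis
        using v by (simp add: power2_eq_square power3_eq_cube)
    qed
    finally show ?thesis
      using v unfolding v_def by simp
  qed
  ultimately show ?thesis
    by (simp add: p_def)
qed

section \<open>WZ pairs\<close>

text \<open>\<open>F2 q n k\<close> is very-well-poised in \<open>k\<close> with base \<open>q\<^sup>2\<close> and \<open>a = q ^ (2 * n + 2)\<close>: its parameters are
  \<open>q\<close>, \<open>q\<close>, \<open>q ^ (n + 1)\<close> and \<open>q ^ (n + 2)\<close>, so that \<open>n\<close> advances by half a step of the base.\<close>

definition weight2 :: "complex \<Rightarrow> nat \<Rightarrow> complex" where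
  "weight2 q n = q ^ (n + 1 choose 2) * (qpoch q q n ^ 2 * qpoch (q^2) (q^2) n / qpoch q (q^2) n)"

text \<open>The well-poised quotients have collapsed. Each parameter q gives (q;q^2)_(n+1) over the
  shifted product, up to a factor free of k; q^(n+2) cancels against its own partner; and q^(n+1)
  leaves 1 / (1 - q^(2k+n+1)), which reduces 1 - q^(4k+2n+2) to the factor with the plus
  sign.\<close>

definition F2 :: "complex \<Rightarrow> nat \<Rightarrow> nat \<Rightarrow> complex" where
  "F2 q n k = weight2 q n * q ^ ((2 * n + 1) * k) * (1 + q ^ (2 * k + 1 + n)) /
     (qpoch (q * (q^2) ^ k) (q^2) (Suc n)) ^ 2"

text \<open>The WZ mate of \<open>F2\<close>. At k = 0 its linear factor is 1 - q^(3n+2), the source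
  of the q-integer [3n+2].\<close>

definition G2 :: "complex \<Rightarrow> nat \<Rightarrow> nat \<Rightarrow> complex" where
  "G2 q n k = weight2 q n / (1 - q ^ (2 * n + 1)) * q ^ ((2 * n + 1) * k) * (1 - q ^ (3 * n + 2 + 2 * k)) /
     (qpoch (q * (q^2) ^ k) (q^2) (Suc n)) ^ 2"

lemma wz2:
  assumes q: "norm q < 1"
  shows "F2 q (Suc n) k - F2 q n k = G2 q n (Suc k) - G2 q n k"
proof -
  define x where "x = q ^ (2 * k)"
  define m where "m = q ^ n"
  define e where "e = q ^ ((2 * n + 1) * k)"
  \<comment> \<open>\<open>D\<close> serves as common denominator: it is the product in
    \<open>F2 q (Suc n) k\<close>, and the other products arise from it by dropping the last factor
    (at k) or the first (at k + 1).\<close>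
  define D where "D = qpoch (q * (q^2) ^ k) (q^2) (Suc (Suc n))"
  define h where "h = weight2 q n / (1 - q * m^2)"
  have p: "norm (q^2) < 1"
    using norm_square_less_1[OF q] .
  have x2: "(q^2) ^ k = x" and m2: "(q^2) ^ n = m^2"
    by (simp_all add: x_def m_def mult.commute flip: power_mult)
  have nx: "norm (q * x) < 1"
    using power_le_one[of "norm q" "2 * k"] q mult_left_le[of "norm q ^ (2 * k)" "norm q"]
    unfolding x_def norm_mult norm_power by (simp add: order.strict_trans1)
  have D0: "D \<noteq> 0"
    unfolding D_def x2 by (rule qpoch_nonzero[OF nx p])
  have D1: "D = qpoch (q * (q^2) ^ k) (q^2) (Suc n) * (1 - x * q^3 * m^2)"
  proof -
    have "q * (q^2) ^ k * (q^2) ^ Suc n = x * q^3 * m^2"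
      unfolding power_Suc x2 m2 by (simp add: eval_nat_numeral)
    then show ?thesis
      unfolding D_def qpoch_Suc[of _ _ "Suc n"] by simp
  qed
  have D2: "D = (1 - x * q) * qpoch (q * (q^2) ^ Suc k) (q^2) (Suc n)"
    unfolding D_def qpoch_Suc'[of _ _ "Suc n"] by (simp add: x2 mult_ac)
  have i1: "z / (qpoch (q * (q^2) ^ k) (q^2) (Suc n)) ^ 2 = z * (1 - x * q^3 * m^2) ^ 2 / D ^ 2" for z
    using D0 unfolding D1 by (simp add: power_mult_distrib)
  have i2: "z / (qpoch (q * (q^2) ^ Suc k) (q^2) (Suc n)) ^ 2 = z * (1 - x * q) ^ 2 / D ^ 2" for z
    using D0 unfolding D2 by (simp add: power_mult_distrib)
  have nzm: "1 - q * m^2 \<noteq> 0"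
    using power_neq_1[OF q, of "Suc (2 * n)"] by (simp add: m_def power_mult power_mult_distrib flip: power_mult) (simp add: mult.commute)
  have f0: "weight2 q n = h * (1 - q * m^2)"
    using nzm by (simp add: h_def)
  have f1: "weight2 q (Suc n) = h * (q * m * (1 - q * m) ^ 2 * (1 - q^2 * m^2))"
    unfolding h_def weight2_def choose_2_Suc_Suc power_add[of q "n + 1 choose 2"] qpoch_Suc m2
    by (simp add: m_def power_mult_distrib mult_ac)
  have p1: "q ^ ((2 * Suc n + 1) * k) = e * x" "q ^ ((2 * n + 1) * Suc k) = e * q * m^2"
    "q ^ (2 * k + 1 + Suc n) = x * q^2 * m" "q ^ (2 * k + 1 + n) = x * q * m"
    "q ^ (3 * n + 2 + 2 * k) = q^2 * m^3 * x"
    "q ^ (2 * n + 1) = q * m^2"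
    unfolding e_def x_def m_def
    by (simp_all flip: power_mult power_add power_Suc power_Suc2 add: algebra_simps)
  have p2: "q ^ (3 * n + 2 + 2 * Suc k) = q^4 * m^3 * x"
  proof -
    have "q ^ (3 * n + 2 + 2 * Suc k) = q ^ (4 + n * 3 + 2 * k)"
      by (rule arg_cong[where f = "power q"]) simp
    then show ?thesis
      unfolding m_def x_def by (simp only: power_add power_mult)
  qed
  have a: "F2 q (Suc n) k = h * (q * m * (1 - q * m) ^ 2 * (1 - q^2 * m^2)) * (e * x) * (1 + x * q^2 * m) / D^2"
    unfolding F2_def f1 p1 D_def ..
  have b: "F2 q n k = h * (1 - q * m^2) * e * (1 + x * q * m) * (1 - x * q^3 * m^2)^2 / D^2"
    unfolding F2_def f0 p1 i1 e_def ..
  have c: "G2 q n (Suc k) = h * (e * q * m^2) * (1 - q^4 * m^3 * x) * (1 - x * q)^2 / D^2"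
    unfolding G2_def p1 p2 i2 h_def ..
  have d: "G2 q n k = h * e * (1 - q^2 * m^3 * x) * (1 - x * q^3 * m^2)^2 / D^2"
    unfolding G2_def p1 i1 h_def e_def ..
  show ?thesis
    unfolding a b c d diff_divide_distrib [symmetric]
    by (rule arg_cong[where f = "\<lambda>z. z / D^2"]) algebra
qed

lemma companion2:
  assumes q: "norm q < 1"
  shows "(\<lambda>n. G2 q n 0) sums ((qpoch_inf (q^2) (q^2)) ^ 4 / (qpoch_inf q (q^2)) ^ 4)"
proof -
  have p: "norm (q^2) < 1"
    using norm_square_less_1[OF q] .
  have nz: "q * (q^2) ^ i \<noteq> 1" for i
    using mult_power_neq_1[OF q p] .
  have inv: "bounded (range (\<lambda>x. inverse (qpoch q (q^2) (n x))))" for n :: "'x \<Rightarrow> nat"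
    using bounded_inverse_qpoch[OF p nz, of "\<lambda>_. 0" n] by simp
  have "bounded (range (\<lambda>x. qpoch q q (fst x) * qpoch q q (fst x) * qpoch (q^2) (q^2) (fst x) *
      inverse (qpoch q (q^2) (fst x)) * (1 + q ^ (2 * snd x + 1 + fst x)) *
      inverse (qpoch (q * (q^2) ^ snd x) (q^2) (Suc (fst x))) * inverse (qpoch (q * (q^2) ^ snd x) (q^2) (Suc (fst x)))))"
    using q p nz
    by (intro bounded_range_mult bounded_qpoch inv bounded_inverse_qpoch bounded_plus_comp bounded_power) auto
  then obtain C where C: "norm (qpoch q q n * qpoch q q n * qpoch (q^2) (q^2) n *
      inverse (qpoch q (q^2) n) * (1 + q ^ (2 * k + 1 + n)) *
      inverse (qpoch (q * (q^2) ^ k) (q^2) (Suc n)) * inverse (qpoch (q * (q^2) ^ k) (q^2) (Suc n))) \<le> C" for n k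
    unfolding bounded_iff by (auto simp del: norm_mult)
  have C0: "C \<ge> 0"
    using order_trans[OF norm_ge_zero C] .
  have le: "n + k \<le> (n + 1 choose 2) + (2 * n + 1) * k" for n k :: nat
    using choose_2_ge[of n] by simp
  have bound: "norm (F2 q n k) \<le> C * norm q ^ n * norm q ^ k" for n k
  proof -
    have "F2 q n k = qpoch q q n * qpoch q q n * qpoch (q^2) (q^2) n *
      inverse (qpoch q (q^2) n) * (1 + q ^ (2 * k + 1 + n)) *
      inverse (qpoch (q * (q^2) ^ k) (q^2) (Suc n)) * inverse (qpoch (q * (q^2) ^ k) (q^2) (Suc n)) *
      q ^ ((n + 1 choose 2) + (2 * n + 1) * k)"
      unfolding F2_def weight2_def power_add[of q "n + 1 choose 2"]
      by (simp only: divide_inverse power2_eq_square inverse_mult_distrib mult_ac)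
    also have "norm \<dots> \<le> C * norm q ^ (n + k)"
      unfolding norm_mult[of _ "q ^ ((n + 1 choose 2) + (2 * n + 1) * k)"]
      by (intro mult_mono C norm_power_le_power q le C0) auto
    finally show ?thesis
      by (simp add: power_add mult_ac)
  qed
  have G: "G2 q n \<longlonglongrightarrow> 0" for n
  proof -
    have "bounded (range (\<lambda>k. (1 - q ^ (3 * n + 2 + 2 * k)) *
      inverse (qpoch (q * (q^2) ^ k) (q^2) (Suc n)) * inverse (qpoch (q * (q^2) ^ k) (q^2) (Suc n))))"
      using q p nz by (intro bounded_range_mult bounded_inverse_qpoch bounded_minus_comp bounded_power) auto
    moreover have "norm (q ^ (2 * n + 1)) < 1"
      using q by (simp add: norm_power power_less_one_iff del: power_Suc)
    ultimately have "(\<lambda>k. (1 - q ^ (3 * n + 2 + 2 * k)) *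
      inverse (qpoch (q * (q^2) ^ k) (q^2) (Suc n)) * inverse (qpoch (q * (q^2) ^ k) (q^2) (Suc n)) *
      (q ^ (2 * n + 1)) ^ k) \<longlonglongrightarrow> 0"
      by (rule bounded_times_geometric_tendsto_0)
    from tendsto_mult_right_zero[OF this, of "weight2 q n / (1 - q ^ (2 * n + 1))"]
    show ?thesis
      by (simp only: G2_def [abs_def] power_mult [symmetric] divide_inverse power2_eq_square inverse_mult_distrib mult_ac)
  qed
  have "(\<lambda>n. G2 q n 0) sums (\<Sum>k. F2 q 0 k)"
  proof (rule wz_companion[where c = "\<lambda>n. C * norm q ^ n" and b = "\<lambda>k. norm q ^ k", OF wz2[OF q] bound _ _ G])
    show "(\<lambda>n. C * norm q ^ n) \<longlonglongrightarrow> 0"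
      using q by (intro tendsto_mult_right_zero LIMSEQ_power_zero) auto
    show "summable (\<lambda>k. norm q ^ k)"
      using q by (intro summable_geometric) auto
  qed
  moreover have "F2 q 0 = (\<lambda>k. q ^ k * (1 + q ^ (2 * k + 1)) / (1 - q ^ (2 * k + 1)) ^ 2)"
    by (simp add: F2_def weight2_def qpoch_Suc fun_eq_iff power_mult binomial_eq_0)
  ultimately show ?thesis
    using sums_unique[OF lambert_sum[OF q]] by simp
qed

section \<open>The WZ pair of the third identity\<close>

lemma rpoch_zero: "rpoch 0 (q^2) k * q ^ k = (-1) ^ k * q ^ (k^2)"
proof (induction k)
  case (Suc k)
  have "rpoch 0 (q^2) (Suc k) * q ^ Suc k = (rpoch 0 (q^2) k * q ^ k) * (- (q ^ (2 * k + 1)))"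
    by (simp add: rpoch_Suc mult_ac flip: power_mult)
  also have "\<dots> = (-1) ^ Suc k * q ^ (k^2 + (2 * k + 1))"
    unfolding Suc power_add[of q "k^2"] by simp
  also have "k^2 + (2 * k + 1) = (Suc k)^2"
    by (simp add: power2_eq_square)
  finally show ?case .
qed simp

text \<open>\<open>F3 q n k\<close> is very-well-poised in \<open>k\<close> with base \<open>q\<^sup>2\<close> and \<open>a = q ^ (6 * n + 1)\<close>, with three
  parameters \<open>q ^ (2 * n + 1)\<close>.\<close>

definition F3 :: "complex \<Rightarrow> nat \<Rightarrow> nat \<Rightarrow> complex" where
  "F3 q n k = (-1) ^ k * q ^ (6 * n^2 + 6 * n * k + k^2) * (1 - q ^ (6 * n + 1 + 4 * k)) *
     (qpoch q (q^2) (n + k) ^ 3 * qpoch q (q^2) n ^ 3 / qpoch (q^2) (q^2) (2 * n + k) ^ 3)"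

text \<open>Sign, power of q and shifted factorials are those of \<open>F3 q n (Suc k)\<close>; only
  the linear factor differs.\<close>

definition H3 :: "complex \<Rightarrow> nat \<Rightarrow> nat \<Rightarrow> complex" where
  "H3 q n k = - ((-1) ^ k) * q ^ (6 * n^2 + 6 * n + 1 + 6 * n * k + k^2 + 2 * k) * (1 - q ^ (6 * n + 3 + 2 * k)) *
     (qpoch q (q^2) (Suc (n + k)) ^ 3 * qpoch q (q^2) n ^ 3 / qpoch (q^2) (q^2) (Suc (2 * n + k)) ^ 3)"

text \<open>The \<open>6\<phi>5\<close> sum with a = q, two parameters q and the third infinite. The
  factor (a;p)_k supplies the third copy of (q;q^2)_k, and the infinite parameter supplies the sign
  and q^(k^2).\<close>

lemma F3_0_sums:
  assumes q: "norm q < 1"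
  shows "F3 q 0 sums (qpoch_inf q (q^2) ^ 2 / qpoch_inf (q^2) (q^2) ^ 2)"
proof (cases "q = 0")
  case True
  have "F3 q 0 = (\<lambda>k. if k = 0 then 1 else 0)"
    by (auto simp: F3_def True fun_eq_iff)
  then show ?thesis
    using sums_single[of 0 "\<lambda>_. 1 :: complex"] by (simp add: True)
next
  case False
  define p where "p = q^2"
  have p: "norm p < 1"
    using q norm_square_less_1 p_def by auto
  have pars: "q * p * (1 / q) = p" "p * (1 / q) = q"
    using False by (simp_all add: p_def field_simps eval_nat_numeral)
  have nz: "q * p * (1 / q) * p ^ i \<noteq> 1" "q * p * p ^ i \<noteq> 1" for i
    unfolding pars using mult_power_neq_1[OF p p] mult_power_neq_1[OF q p, of "Suc i"] by (simp_all add: mult.assoc)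
  have "wp_term q p (1 / q) (1 / q) 0 sums (qpoch_inf q p * qpoch_inf q p / (qpoch_inf p p * qpoch_inf p p))"
    using wp_sum[OF p _ nz(1) nz(1) _ nz(2), of 0] unfolding pars by simp
  moreover have "wp_term q p (1 / q) (1 / q) 0 = F3 q 0"
  proof (rule ext)
    fix k
    have "wp_term q p (1 / q) (1 / q) 0 k =
        (1 - q * p ^ (2 * k)) * (rpoch 0 p k * ((q * p) ^ k / (q ^ k) ^ 2)) * (qpoch q p k ^ 3 / qpoch p p k ^ 3)"
      unfolding wp_term_def pars rpoch_inverse[OF False] by (simp add: eval_nat_numeral) (simp add: mult_ac)
    also have "(q * p) ^ k / (q ^ k) ^ 2 = q ^ k"
      using False by (simp add: p_def power_mult_distrib flip: power_mult) (simp add: mult.commute)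
    also have "rpoch 0 p k * q ^ k = (-1) ^ k * q ^ (k^2)"
      unfolding p_def by (rule rpoch_zero)
    also have "q * p ^ (2 * k) = q ^ (1 + 4 * k)"
      by (simp add: p_def flip: power_mult)
    finally show "wp_term q p (1 / q) (1 / q) 0 k = F3 q 0 k"
      by (simp add: F3_def p_def)
  qed
  ultimately show ?thesis
    by (simp add: p_def power2_eq_square[of "qpoch_inf _ _"])
qed

text \<open>The relation runs along the antidiagonal from (n, k+1) to (n+1, k), where n + k + 1
  stays fixed and 2n + k + 1 grows by one, so few factors change. Adding
  \<open>F3 q n (Suc k) - F3 q n k\<close> to both sides gives a WZ pair with mate
  \<open>F3 + H3\<close>.\<close>

lemma wz3:
  assumes q: "norm q < 1"
  shows "F3 q (Suc n) k - F3 q n (Suc k) = H3 q n (Suc k) - H3 q n k"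
proof -
  define p where "p = q^2"
  define m where "m = q ^ (2 * n)"
  define y where "y = q ^ (2 * k)"
  define A where "A = qpoch q p (Suc (n + k))"
  define B where "B = qpoch q p n"
  define P where "P = qpoch p p (Suc (Suc (2 * n + k)))"
  define e where "e = (-1) ^ k * q ^ (6 * n^2 + 6 * n + 1 + 6 * n * k + k^2 + 2 * k)"
  have p: "norm p < 1"
    using norm_square_less_1[OF q] p_def by simp
  have P0: "P \<noteq> 0"
    unfolding P_def by (rule qpoch_nonzero[OF p p])
  have P1: "P = qpoch p p (Suc (2 * n + k)) * (1 - m^2 * q^4 * y)"
  proof -
    have "p * p ^ Suc (2 * n + k) = q ^ (2 + 2 * Suc (2 * n + k))"
      unfolding p_def by (simp only: power_add power_mult)
    also have "2 + 2 * Suc (2 * n + k) = 2 * n * 2 + 4 + 2 * k"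
      by simp
    also have "q ^ (2 * n * 2 + 4 + 2 * k) = m^2 * q^4 * y"
      unfolding m_def y_def by (simp only: power_add power_mult)
    finally show ?thesis
      unfolding P_def qpoch_Suc[of _ _ "Suc (2 * n + k)"] by simp
  qed
  have i1: "z / qpoch p p (Suc (2 * n + k)) ^ 3 = z * (1 - m^2 * q^4 * y) ^ 3 / P ^ 3" for z
    using P0 unfolding P1 by (simp add: power_mult_distrib)
  have B1: "qpoch q p (Suc n) = B * (1 - m * q)"
    by (simp add: B_def qpoch_Suc p_def m_def power_mult)
  have A1: "qpoch q p (Suc (Suc (n + k))) = A * (1 - m * q^3 * y)"
  proof -
    have "q * p ^ Suc (n + k) = q ^ (1 + 2 * Suc (n + k))"
      unfolding p_def by (simp only: power_add power_mult power_one_right)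
    also have "1 + 2 * Suc (n + k) = 2 * n + 3 + 2 * k"
      by simp
    also have "q ^ (2 * n + 3 + 2 * k) = m * q^3 * y"
      unfolding m_def y_def by (simp only: power_add)
    finally show ?thesis
      unfolding A_def qpoch_Suc[of _ _ "Suc (n + k)"] by simp
  qed
  have "q ^ (6 * (Suc n)^2 + 6 * Suc n * k + k^2) =
      q ^ (6 * n^2 + 6 * n + 1 + 6 * n * k + k^2 + 2 * k + (2 * n * 3 + 5 + 2 * k * 2))"
    "q ^ (6 * n^2 + 6 * n * Suc k + (Suc k)^2) = q ^ (6 * n^2 + 6 * n + 1 + 6 * n * k + k^2 + 2 * k)"
    "q ^ (6 * n^2 + 6 * n + 1 + 6 * n * Suc k + (Suc k)^2 + 2 * Suc k) =
      q ^ (6 * n^2 + 6 * n + 1 + 6 * n * k + k^2 + 2 * k + (2 * n * 3 + 3 + 2 * k))"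
    by (rule arg_cong[where f = "power q"], simp add: power2_eq_square algebra_simps)+
  then have e1: "(-1) ^ k * q ^ (6 * (Suc n)^2 + 6 * Suc n * k + k^2) = e * (m^3 * q^5 * y^2)"
    "(-1) ^ Suc k * q ^ (6 * n^2 + 6 * n * Suc k + (Suc k)^2) = - e"
    "- ((-1) ^ Suc k) * q ^ (6 * n^2 + 6 * n + 1 + 6 * n * Suc k + (Suc k)^2 + 2 * Suc k) = e * (m^3 * q^3 * y)"
    unfolding e_def m_def y_def power_add[of q "_ + 2 * k"] power_add[of q "2 * n * 3 + _"] power_add[of q "2 * n * 3"]
      power_mult[of q "2 * n" 3] power_mult[of q "2 * k" 2]
    by simp_all
  have e2: "q ^ (6 * Suc n + 1 + 4 * k) = m^3 * q^7 * y^2" "q ^ (6 * n + 1 + 4 * Suc k) = m^3 * q^5 * y^2"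
    "q ^ (6 * n + 3 + 2 * Suc k) = m^3 * q^5 * y" "q ^ (6 * n + 3 + 2 * k) = m^3 * q^3 * y"
    unfolding m_def y_def
    by (simp_all flip: power_mult power_add power_Suc power_Suc2 add: algebra_simps)
  have idx: "Suc n + k = Suc (n + k)" "2 * Suc n + k = Suc (Suc (2 * n + k))" "n + Suc k = Suc (n + k)"
    "2 * n + Suc k = Suc (2 * n + k)"
    by simp_all
  have a: "F3 q (Suc n) k = e * (m^3 * q^5 * y^2) * (1 - m^3 * q^7 * y^2) * (A ^ 3 * (B * (1 - m * q)) ^ 3 / P ^ 3)"
    unfolding F3_def e1 e2 idx p_def [symmetric] B1 A_def P_def ..
  have b: "F3 q n (Suc k) = - e * (1 - m^3 * q^5 * y^2) * (A ^ 3 * B ^ 3 * (1 - m^2 * q^4 * y) ^ 3 / P ^ 3)"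
    unfolding F3_def e1 e2 idx p_def [symmetric] i1 A_def B_def ..
  have c: "H3 q n (Suc k) = e * (m^3 * q^3 * y) * (1 - m^3 * q^5 * y) * ((A * (1 - m * q^3 * y)) ^ 3 * B ^ 3 / P ^ 3)"
    unfolding H3_def e1 e2 idx p_def [symmetric] A1 B_def P_def ..
  have d: "H3 q n k = - e * (1 - m^3 * q^3 * y) * (A ^ 3 * B ^ 3 * (1 - m^2 * q^4 * y) ^ 3 / P ^ 3)"
    unfolding H3_def e2 p_def [symmetric] i1 A_def B_def e_def by simp
  show ?thesis
    unfolding a b c d times_divide_eq_right diff_divide_distrib [symmetric]
    by (rule arg_cong[where f = "\<lambda>z. z / P^3"]) algebra
qed

lemma companion3:
  assumes q: "norm q < 1"
  shows "(\<lambda>n. F3 q n 0 + H3 q n 0) sums (qpoch_inf q (q^2) ^ 2 / qpoch_inf (q^2) (q^2) ^ 2)"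
proof -
  have p: "norm (q^2) < 1"
    using norm_square_less_1[OF q] .
  have inv: "bounded (range (\<lambda>x. inverse (qpoch (q^2) (q^2) (n x))))" for n :: "'x \<Rightarrow> nat"
    using bounded_inverse_qpoch[OF p mult_power_neq_1[OF p p], of "\<lambda>_. 0" n] by simp
  have sgn: "bounded (range (\<lambda>x. (-1) ^ n x :: complex))" for n :: "'x \<Rightarrow> nat"
    by (rule boundedI[where B = 1]) (auto simp: norm_power)
  have cube: "bounded (range (\<lambda>x. f x ^ 3))" if "bounded (range f)" for f :: "'x \<Rightarrow> complex"
    using that unfolding power3_eq_cube by (intro bounded_range_mult)
  have "bounded (range (\<lambda>x. (-1) ^ snd x * (1 - q ^ (6 * fst x + 1 + 4 * snd x)) *
     (qpoch q (q^2) (fst x + snd x) ^ 3 * qpoch q (q^2) (fst x) ^ 3 * inverse (qpoch (q^2) (q^2) (2 * fst x + snd x)) ^ 3)))"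
    using p q
    by (intro bounded_range_mult bounded_qpoch inv sgn cube bounded_minus_comp bounded_power) auto
  then obtain C where C: "norm ((-1) ^ k * (1 - q ^ (6 * n + 1 + 4 * k)) *
     (qpoch q (q^2) (n + k) ^ 3 * qpoch q (q^2) n ^ 3 * inverse (qpoch (q^2) (q^2) (2 * n + k)) ^ 3)) \<le> C" for n k
    unfolding bounded_iff by (auto simp del: norm_mult)
  have C0: "C \<ge> 0"
    using order_trans[OF norm_ge_zero C] .
  have bound: "norm (F3 q n k) \<le> C * norm q ^ n * norm q ^ k" for n k
  proof -
    have "n + k \<le> 6 * n^2 + 6 * n * k + k^2"
      using power2_nat_le_eq_le[of n] self_le_power[of n 2] self_le_power[of k 2] by (cases n; cases k) auto
    moreover have "F3 q n k = ((-1) ^ k * (1 - q ^ (6 * n + 1 + 4 * k)) *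
     (qpoch q (q^2) (n + k) ^ 3 * qpoch q (q^2) n ^ 3 * inverse (qpoch (q^2) (q^2) (2 * n + k)) ^ 3)) *
      q ^ (6 * n^2 + 6 * n * k + k^2)"
      unfolding F3_def by (simp only: divide_inverse power_inverse mult_ac)
    ultimately have "norm (F3 q n k) \<le> C * norm q ^ (n + k)"
      using C C0 q by (simp only: norm_mult[of _ "q ^ (6 * n^2 + 6 * n * k + k^2)"]) (intro mult_mono norm_power_le_power; simp)
    then show ?thesis
      by (simp add: power_add mult_ac)
  qed
  have F: "F3 q n \<longlonglongrightarrow> 0" for n
  proof (rule Lim_null_comparison)
    show "\<forall>\<^sub>F k in sequentially. norm (F3 q n k) \<le> C * norm q ^ n * norm q ^ k"
      using bound by simp
    show "(\<lambda>k. C * norm q ^ n * norm q ^ k) \<longlonglongrightarrow> 0"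
      using q by (intro tendsto_mult_right_zero LIMSEQ_power_zero) auto
  qed
  have H: "H3 q n \<longlonglongrightarrow> 0" for n
  proof -
    \<comment> \<open>One power \<open>q ^ k\<close> is split off from the part \<open>2 * k\<close>
      of the exponent; it forces decay even when n = 0.\<close>
    have "bounded (range (\<lambda>k. (-1) ^ k * q ^ (6 * n^2 + 6 * n + 1 + 6 * n * k + k^2 + k) *
        (1 - q ^ (6 * n + 3 + 2 * k)) *
        (qpoch q (q^2) (Suc (n + k)) ^ 3 * inverse (qpoch (q^2) (q^2) (Suc (2 * n + k))) ^ 3)))"
      using p q
      by (intro bounded_range_mult sgn bounded_qpoch inv cube bounded_minus_comp bounded_power) auto
    note lim = bounded_times_geometric_tendsto_0[OF this q]
    have "H3 q n = (\<lambda>k. - (qpoch q (q^2) n ^ 3) *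
        ((-1) ^ k * q ^ (6 * n^2 + 6 * n + 1 + 6 * n * k + k^2 + k) * (1 - q ^ (6 * n + 3 + 2 * k)) *
        (qpoch q (q^2) (Suc (n + k)) ^ 3 * inverse (qpoch (q^2) (q^2) (Suc (2 * n + k))) ^ 3) * q ^ k))"
    proof
      fix k
      have pw: "q ^ (6 * n^2 + 6 * n + 1 + 6 * n * k + k^2 + 2 * k) =
          q ^ (6 * n^2 + 6 * n + 1 + 6 * n * k + k^2 + k) * q ^ k"
        unfolding power_add [of q _ k, symmetric] by (rule arg_cong[where f = "power q"]) simp
      show "H3 q n k = - (qpoch q (q^2) n ^ 3) *
        ((-1) ^ k * q ^ (6 * n^2 + 6 * n + 1 + 6 * n * k + k^2 + k) * (1 - q ^ (6 * n + 3 + 2 * k)) *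
        (qpoch q (q^2) (Suc (n + k)) ^ 3 * inverse (qpoch (q^2) (q^2) (Suc (2 * n + k))) ^ 3) * q ^ k)"
        unfolding H3_def pw divide_inverse power_inverse by simp
    qed
    then show ?thesis
      using tendsto_mult_right_zero[OF lim] by (simp only:)
  qed
  have "(\<lambda>n. F3 q n 0 + H3 q n 0) sums (\<Sum>k. F3 q 0 k)"
  proof (rule wz_companion[where c = "\<lambda>n. C * norm q ^ n" and b = "\<lambda>k. norm q ^ k"
        and G = "\<lambda>n k. F3 q n k + H3 q n k", OF _ bound])
    show "F3 q (Suc n) k - F3 q n k = F3 q n (Suc k) + H3 q n (Suc k) - (F3 q n k + H3 q n k)" for n k
      using wz3[OF q, of n k] by (simp add: algebra_simps)
    show "(\<lambda>n. C * norm q ^ n) \<longlonglongrightarrow> 0"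
      using q by (intro tendsto_mult_right_zero LIMSEQ_power_zero) auto
    show "summable (\<lambda>k. norm q ^ k)"
      using q by (intro summable_geometric) auto
    show "(\<lambda>k. F3 q n k + H3 q n k) \<longlonglongrightarrow> 0" for n
      using tendsto_add[OF F H] by simp
  qed
  then show ?thesis
    using sums_unique[OF F3_0_sums[OF q]] by simp
qed

section \<open>Matching the companions with the stated summands\<close>

text \<open>With m = 2n + 1, (q^2;q^2)_m = (q;q)_m (-q;q)_m; the first factor splits into odd and
  even powers of q, and the second is (1 + q) (-q^2;q)_(2n).\<close>

lemma qpoch_split:
  "qpoch (q^2) (q^2) (Suc (2 * n)) =
   qpoch q (q^2) (Suc n) * qpoch (q^2) (q^2) n * ((1 + q) * qpoch (- (q^2)) q (2 * n))"
proof (induction n)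
  case 0
  show ?case
    by (simp add: qpoch_Suc) algebra
next
  case (Suc n)
  define m where "m = q ^ (2 * n)"
  have pw: "(q^2) ^ n = m" "(q^2) ^ (2 * n) = m^2" "q ^ (2 * n) = m"
    by (simp_all add: m_def flip: power_mult)
  have two: "2 * Suc n = Suc (Suc (2 * n))"
    by simp
  show ?case
    unfolding two qpoch_Suc[of _ _ "Suc (2 * n)"] qpoch_Suc[of _ _ "Suc (Suc (2 * n))"]
      qpoch_Suc[of "- (q^2)"] qpoch_Suc[of q "q^2" "Suc n"] Suc
    unfolding qpoch_Suc[of "q^2" "q^2" n] power_Suc pw
    by algebra
qed

lemma q_int_eq: "(1 - q) * q_int q n = 1 - q ^ n"
  unfolding q_int_def by (rule one_diff_power_eq [symmetric])

theorem theorem1p3: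
  fixes q :: complex
  assumes "norm q < 1"
  shows "((\<lambda>k::nat. q ^ ((k + 1) choose 2) * (qpoch q q k / qpoch (q^3) (q^2) k))
           sums ((qpoch_inf (q^2) (q^2))^2 / (qpoch_inf q (q^2) * qpoch_inf (q^3) (q^2))))
       \<and> ((\<lambda>k::nat. q ^ ((k + 1) choose 2) * q_int q (3 * k + 2) *
               ((qpoch q q k)^2 * qpoch (q^2) (q^2) k / (qpoch (q^3) (q^2) k)^3))
           sums ((qpoch_inf (q^2) (q^2))^4 / ((qpoch_inf q (q^2))^2 * (qpoch_inf (q^3) (q^2))^2)))
       \<and> ((\<lambda>k::nat. q ^ (6 * k^2) * ((qpoch q (q^2) k)^3 / (qpoch (q^2) (q^2) k)^3) *
               (((1 + q ^ (1 + 2 * k))^3 * (1 - q ^ (1 + 6 * k))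
                   - q ^ (1 + 6 * k) * (1 - q ^ (3 + 6 * k)))
                / ((1 - q^3) * (1 + q) * (qpoch (- (q^2)) q (2 * k))^3)))
           sums (qpoch_inf (q^3) (q^2) * qpoch_inf (q^5) (q^2) / (qpoch_inf (q^4) (q^2))^2))"
proof (intro conjI)
  note q = assms
  define p where "p = q^2"
  have p: "norm p < 1"
    using norm_square_less_1[OF q] p_def by simp
  have qn: "norm (q ^ n) < 1" if "n > 0" for n
    using q that by (simp add: norm_power power_less_one_iff)
  have pw: "q * p = q^3" "q^3 * p = q^5" "p * p = q^4"
    by (simp_all add: p_def flip: power_Suc power_add)
  have inf_q: "qpoch_inf q p = (1 - q) * qpoch_inf (q^3) p"
    and inf_q3: "qpoch_inf (q^3) p = (1 - q^3) * qpoch_inf (q^5) p"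
    and inf_p: "qpoch_inf p p = (1 - p) * qpoch_inf (q^4) p"
    using qpoch_inf_Suc[OF p, of q] qpoch_inf_Suc[OF p, of "q^3"] qpoch_inf_Suc[OF p, of p]
    unfolding pw by auto
  have ne: "1 - q \<noteq> 0" "1 - q^3 \<noteq> 0" "1 - p \<noteq> 0" "1 + q \<noteq> 0"
    using power_neq_1[OF q, of 1] power_neq_1[OF q, of 3] power_neq_1[OF q, of 2] 
    by (auto simp: p_def add_eq_0_iff power2_eq_square)
  have q3_nz: "qpoch (q^3) p n \<noteq> 0" for n
    using qpoch_nonzero[OF qn p] by simp
  have q_Suc: "qpoch q p (Suc n) = (1 - q) * qpoch (q^3) p n" for n
    using qpoch_Suc'[of q p n] unfolding pw .

  have "qg_term q q q sums (qpoch_inf (q * q) (q^2) * qpoch_inf (q * q) (q^2) /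
      (qpoch_inf q (q^2) * qpoch_inf (q * q * q) (q^2)))"
    using mult_power_neq_1[OF qn[of 3] p] by (intro qg_sum[OF q]) (simp add: p_def power3_eq_cube)
  moreover have "qg_term q q q = (\<lambda>k. q ^ ((k + 1) choose 2) * (qpoch q q k / qpoch (q^3) (q^2) k))"
    using qpoch_nonzero[OF q q] by (simp add: qg_term_def power3_eq_cube fun_eq_iff)
  ultimately show "(\<lambda>k::nat. q ^ ((k + 1) choose 2) * (qpoch q q k / qpoch (q^3) (q^2) k))
           sums ((qpoch_inf (q^2) (q^2))^2 / (qpoch_inf q (q^2) * qpoch_inf (q^3) (q^2)))"
    by (simp add: power2_eq_square power3_eq_cube mult_ac)

  \<comment> \<open>Three uses of (q;q^2)_(k+1) = (1 - q) (q^3;q^2)_k give (1 - q)^3 in the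
    denominator; 1 - q^(3k+2) = (1 - q) [3k+2] takes one power back.\<close>
  have "(1 - q)^2 * G2 q k 0 = q ^ ((k + 1) choose 2) * q_int q (3 * k + 2) *
      ((qpoch q q k)^2 * qpoch p p k / (qpoch (q^3) p k)^3)" for k
  proof -
    define B where "B = qpoch q p k"
    define v where "v = q ^ (2 * k + 1)"
    have "B * (1 - v) = (1 - q) * qpoch (q^3) p k"
      using q_Suc[of k] by (simp add: qpoch_Suc B_def v_def p_def power_mult)
    moreover have "1 - v \<noteq> 0"
      using power_neq_1[OF q, of "2 * k + 1"] by (simp add: v_def)
    ultimately have B: "B = (1 - q) * qpoch (q^3) p k / (1 - v)"
      by (simp add: field_simps)
    have "G2 q k 0 = q ^ (k + 1 choose 2) * (qpoch q q k ^ 2 * qpoch p p k / B) / (1 - v) *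
        (1 - q ^ (3 * k + 2)) / ((1 - q) * qpoch (q^3) p k) ^ 2"
      unfolding G2_def weight2_def B_def v_def p_def [symmetric] using q_Suc[of k] by simp
    then show ?thesis
      using ne(1) q3_nz[of k] \<open>1 - v \<noteq> 0\<close> unfolding B q_int_eq [symmetric]
      by (simp add: power_mult_distrib eval_nat_numeral)
  qed
  then have "(\<lambda>k. q ^ ((k + 1) choose 2) * q_int q (3 * k + 2) *
      ((qpoch q q k)^2 * qpoch p p k / (qpoch (q^3) p k)^3)) sums
      ((1 - q)^2 * (qpoch_inf p p ^ 4 / qpoch_inf q p ^ 4))"
    using sums_mult[OF companion2[OF q], of "(1 - q)^2"] by (simp add: p_def)
  moreover have "(1 - q)^2 * (qpoch_inf p p ^ 4 / qpoch_inf q p ^ 4) =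
      qpoch_inf p p ^ 4 / (qpoch_inf q p ^ 2 * qpoch_inf (q^3) p ^ 2)"
    using ne(1) by (simp add: inf_q power_mult_distrib eval_nat_numeral)
  ultimately show "(\<lambda>k::nat. q ^ ((k + 1) choose 2) * q_int q (3 * k + 2) *
               ((qpoch q q k)^2 * qpoch (q^2) (q^2) k / (qpoch (q^3) (q^2) k)^3))
           sums ((qpoch_inf (q^2) (q^2))^4 / ((qpoch_inf q (q^2))^2 * (qpoch_inf (q^3) (q^2))^2))"
    unfolding p_def by simp

  \<comment> \<open>The companion has (1 + q)^3 in its denominator, by \<open>qpoch_split\<close>
    cubed, where the stated summand has (1 - q^3)(1 + q).\<close>
  have "(1 + q)^2 / (1 - q^3) * (F3 q k 0 + H3 q k 0) =
      q ^ (6 * k^2) * ((qpoch q p k)^3 / (qpoch p p k)^3) *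
               (((1 + q ^ (1 + 2 * k))^3 * (1 - q ^ (1 + 6 * k))
                   - q ^ (1 + 6 * k) * (1 - q ^ (3 + 6 * k)))
                / ((1 - q^3) * (1 + q) * (qpoch (- p) q (2 * k))^3))" for k
  proof -
    define B where "B = qpoch q p k"
    define P where "P = qpoch p p k"
    define E where "E = qpoch (- p) q (2 * k)"
    define R where "R = qpoch p p (2 * k)"
    define v where "v = q ^ (1 + 2 * k)"
    have v: "1 - v \<noteq> 0"
      using power_neq_1[OF q, of "1 + 2 * k"] by (simp add: v_def)
    have nz: "B \<noteq> 0" "P \<noteq> 0" "E \<noteq> 0" "R \<noteq> 0"
      using qpoch_nonzero[OF q p] qpoch_nonzero[OF p p] qpoch_nonzero[of "- p" q] p q
      by (simp_all add: B_def P_def E_def R_def)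
    have Bs: "qpoch q p (Suc k) = B * (1 - v)"
      by (simp add: B_def v_def qpoch_Suc p_def power_mult)
    have Rs: "qpoch p p (Suc (2 * k)) = R * (1 - v^2)"
      by (simp add: R_def v_def qpoch_Suc p_def flip: power_mult power_add power_Suc)
    have split: "R * (1 - v^2) = B * (1 - v) * P * ((1 + q) * E)"
      using qpoch_split[of q k] unfolding p_def [symmetric] Bs Rs P_def [symmetric] E_def [symmetric] .
    have "R * (1 + v) * (1 - v) = B * P * ((1 + q) * E) * (1 - v)"
      using split by algebra
    then have RE: "R * (1 + v) = B * P * ((1 + q) * E)"
      using v by simp
    \<comment> \<open>Extending the fraction to the denominator that \<open>H3\<close> has after
      cancelling (1 - v)^3 is what produces the cube (1 + q^(1+2k))^3.\<close>
    have F: "F3 q k 0 = q ^ (6 * k^2) * (1 - q ^ (1 + 6 * k)) * (B ^ 6 * (1 + v) ^ 3 / (R * (1 + v)) ^ 3)"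
    proof -
      have "1 + v \<noteq> 0"
        using RE nz ne(4) by auto
      then show ?thesis
        by (simp add: F3_def B_def R_def p_def power_mult_distrib flip: power_add)
    qed
    have H: "H3 q k 0 = - (q ^ (6 * k^2) * q ^ (1 + 6 * k)) * (1 - q ^ (3 + 6 * k)) *
        (B ^ 6 / (R * (1 + v)) ^ 3)"
    proof -
      have "H3 q k 0 = - (q ^ (6 * k^2 + 6 * k + 1)) * (1 - q ^ (6 * k + 3)) *
        ((B * (1 - v)) ^ 3 * B ^ 3 / (R * (1 - v^2)) ^ 3)"
        unfolding H3_def p_def [symmetric] add_0_right Bs Rs B_def [symmetric] by simp
      also have "R * (1 - v^2) = R * (1 + v) * (1 - v)"
        by algebra
      also have "(B * (1 - v)) ^ 3 * B ^ 3 / (R * (1 + v) * (1 - v)) ^ 3 = B ^ 6 / (R * (1 + v)) ^ 3"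
        using v unfolding power_mult_distrib [of _ "1 - v"] by (simp flip: power_add)
      finally show ?thesis
        by (simp add: power_add mult_ac)
    qed
    have "F3 q k 0 + H3 q k 0 = q ^ (6 * k^2) *
        ((1 + v) ^ 3 * (1 - q ^ (1 + 6 * k)) - q ^ (1 + 6 * k) * (1 - q ^ (3 + 6 * k))) *
        (B ^ 6 / (B * P * ((1 + q) * E)) ^ 3)"
      unfolding F H RE by (simp add: algebra_simps)
    also have "B ^ 6 / (B * P * ((1 + q) * E)) ^ 3 = B ^ 3 / P ^ 3 / (E ^ 3 * (1 + q) ^ 3)"
      using nz by (simp add: power_mult_distrib eval_nat_numeral)
    finally show ?thesis
      using ne(4) unfolding B_def P_def E_def v_def
      by (simp add: power2_eq_square power3_eq_cube) (simp add: mult_ac)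
  qed
  then have "(\<lambda>k. q ^ (6 * k^2) * ((qpoch q p k)^3 / (qpoch p p k)^3) *
               (((1 + q ^ (1 + 2 * k))^3 * (1 - q ^ (1 + 6 * k))
                   - q ^ (1 + 6 * k) * (1 - q ^ (3 + 6 * k)))
                / ((1 - q^3) * (1 + q) * (qpoch (- p) q (2 * k))^3))) sums
      ((1 + q)^2 / (1 - q^3) * (qpoch_inf q p ^ 2 / qpoch_inf p p ^ 2))"
    using sums_mult[OF companion3[OF q], of "(1 + q)^2 / (1 - q^3)"] by (simp add: p_def)
  moreover have "(1 + q)^2 / (1 - q^3) * (qpoch_inf q p ^ 2 / qpoch_inf p p ^ 2) =
      qpoch_inf (q^3) p * qpoch_inf (q^5) p / qpoch_inf (q^4) p ^ 2"
  proof -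
    have "1 - p = (1 - q) * (1 + q)"
      unfolding p_def by algebra
    then show ?thesis
      using ne unfolding inf_q inf_p inf_q3 by (simp add: power2_eq_square)
  qed
  ultimately show "(\<lambda>k::nat. q ^ (6 * k^2) * ((qpoch q (q^2) k)^3 / (qpoch (q^2) (q^2) k)^3) *
               (((1 + q ^ (1 + 2 * k))^3 * (1 - q ^ (1 + 6 * k))
                   - q ^ (1 + 6 * k) * (1 - q ^ (3 + 6 * k)))
                / ((1 - q^3) * (1 + q) * (qpoch (- (q^2)) q (2 * k))^3)))
           sums (qpoch_inf (q^3) (q^2) * qpoch_inf (q^5) (q^2) / (qpoch_inf (q^4) (q^2))^2)"
    unfolding p_def by simp
qed

end
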